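(* Fix $\kappa\in(0,\infty)$. Let $(\Lambda_n)_{n\in\mathbb{N}}$ be a weak* convergent sequence in $\mathcal{P}(\mathfrak{C})$ with limit $\Lambda\in\mathcal{P}(\mathfrak{C})$, and let $(\nu_n)_{n\in\mathbb{N}}$ be a weak* convergent sequence in $\mathcal{M}_+(\Omega)$ with limit $\nu\in\mathcal{M}_+(\Omega)$. Then $$J_{\Lambda,\kappa}(\nu)=\lim_{n\to\infty}J_{\Lambda_n,\kappa}(\nu_n),$$ where $J_{\Lambda,\kappa}(\nu):=\int_{\mathfrak{C}}\mathrm{HK}_\kappa^2(\mu,\nu)\,d\Lambda(\mu)$.
   Context: $\Omega \subset \mathbb{R}^d$ is a compact convex set with non-empty interior. $\mathcal{M}_+(\Omega)$ denotes the non-negative Radon measures on $\Omega$ with the weak* topology (duality with continuous functions), and $\|\mu\| = \mu(\Omega)$. For $\kappa\in(0,\infty)$ and $\mu,\nu\in\mathcal{M}_+(\Omega)$ the Hellinger--Kantorovich distance is $$\mathrm{HK}_\kappa^2(\mu,\nu) := \inf_{\gamma\in\mathcal{M}_+(\Omega\times\Omega)} \int \hat c_\kappa\,d\gamma + \mathrm{KL}(P_1\gamma|\mu)+\mathrm{KL}(P_2\gamma|\nu),$$ where $P_1\gamma,P_2\gamma$ are the two marginals of $\gamma$, $\hat c_\kappa(x,y) = -2\log\cos(|x-y|/\kappa)$ if $|x-y|\le\kappa\pi/2$ (with $-\log 0=+\infty$) and $+\infty$ otherwise, and $\mathrm{KL}(\mu|\nu)=\int\varphi(d\mu/d\nu)\,d\nu$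 if $\mu\ll\nu$, $\mu\ge0$, and $+\infty$ otherwise, with $\varphi(s)=s\log s-s+1$ for $s>0$, $\varphi(0)=1$. It is known that $\mathrm{HK}_\kappa$ metrizes the weak* topology on $\mathcal{M}_+(\Omega)$. Fix $M\in(0,\infty)$ and let $\mathfrak{C} := \{\mu\in\mathcal{M}_+(\Omega) : \|\mu\|\le M\}$, a compact metrizable space in the weak* topology, equipped with its Borel $\sigma$-algebra; $\mathcal{P}(\mathfrak{C})$ is the set of Borel probability measures on $\mathfrak{C}$, with weak* convergence defined by duality with continuous functions on $\mathfrak{C}$. *)

theory Defs
  imports "HOL-Probability.Probability"
begin

section \<open>Finite Borel measures and the weak* topology on a compact space\<close>

definition borel_of :: "'a topology \<Rightarrow> 'a measure" where
  "borel_of X = sigma (topspace X) {U. openin X U}"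

text \<open>The definitions below are meant for compact metrizable \<open>X\<close> (here \<open>\<Omega>\<close>, \<open>\<Omega> \<times> \<Omega>\<close> and the
  mass-bounded set of measures). There every finite Borel measure is Radon, so no regularity
  condition is imposed, and every continuous function is bounded, hence integrable.\<close>

definition finite_borel_measures :: "'a topology \<Rightarrow> 'a measure set" where
  "finite_borel_measures X = {\<mu>. sets \<mu> = sets (borel_of X) \<and> finite_measure \<mu>}"

definition weak_star :: "'a topology \<Rightarrow> 'a measure topology" where
  "weak_star X = topology_generated_by
     {{\<mu> \<in> finite_borel_measures X. (\<integral>x. f x \<partial>\<mu>) \<in> U} | f U.
        continuous_map X euclideanreal f \<and> open U}"

definition borel_prob_measures :: "'a topology \<Rightarrow> 'a measure set" where
  "borel_prob_measures X = {\<mu> \<in> finite_borel_measures X. prob_space \<mu>}"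

abbreviation Mplus :: "'a::euclidean_space set \<Rightarrow> 'a measure set" where
  "Mplus \<Omega> \<equiv> finite_borel_measures (top_of_set \<Omega>)"

text \<open>The compact space of measures of mass at most \<open>M\<close>, as a subspace of the weak* topology.\<close>

definition mass_bounded :: "'a::euclidean_space set \<Rightarrow> real \<Rightarrow> 'a measure topology" where
  "mass_bounded \<Omega> M =
     subtopology (weak_star (top_of_set \<Omega>)) {\<mu> \<in> Mplus \<Omega>. measure \<mu> \<Omega> \<le> M}"

section \<open>The Hellinger--Kantorovich distance\<close>

text \<open>At \<open>norm (x - y) = \<kappa> * pi / 2\<close> the cost is \<open>- 2 * log 0 = \<infinity>\<close>; since \<open>ln 0 = 0\<close> in HOL, that
  case is sent to the second branch.\<close>

definition hk_cost :: "real \<Rightarrow> 'a::euclidean_space \<Rightarrow> 'a \<Rightarrow> ennreal" where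
  "hk_cost \<kappa> x y =
     (if norm (x - y) < \<kappa> * pi / 2 then ennreal (- 2 * ln (cos (norm (x - y) / \<kappa>))) else \<infinity>)"

definition kl_phi :: "real \<Rightarrow> real" where
  "kl_phi s = (if s > 0 then s * ln s - s + 1 else 1)"

text \<open>\<open>KL \<mu> \<nu>\<close> is the divergence of \<open>\<mu>\<close> relative to the reference measure \<open>\<nu>\<close>. Library argument
  order: \<open>absolutely_continuous \<nu> \<mu>\<close> means \<open>\<mu> \<lless> \<nu>\<close>, and \<open>RN_deriv \<nu> \<mu>\<close> is \<open>d\<mu>/d\<nu>\<close> (finite
  \<open>\<nu>\<close>-almost everywhere for finite measures).\<close>

definition KL :: "'a measure \<Rightarrow> 'a measure \<Rightarrow> ennreal" where
  "KL \<mu> \<nu> = (if absolutely_continuous \<nu> \<mu>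
     then \<integral>\<^sup>+ x. ennreal (kl_phi (enn2real (RN_deriv \<nu> \<mu> x))) \<partial>\<nu> else \<infinity>)"

definition HK_sq :: "'a::euclidean_space set \<Rightarrow> real \<Rightarrow> 'a measure \<Rightarrow> 'a measure \<Rightarrow> ennreal" where
  "HK_sq \<Omega> \<kappa> \<mu> \<nu> = (INF \<gamma> \<in> Mplus (\<Omega> \<times> \<Omega>).
     (\<integral>\<^sup>+ (x, y). hk_cost \<kappa> x y \<partial>\<gamma>)
     + KL (distr \<gamma> (borel_of (top_of_set \<Omega>)) fst) \<mu>
     + KL (distr \<gamma> (borel_of (top_of_set \<Omega>)) snd) \<nu>)"

definition J :: "'a::euclidean_space set \<Rightarrow> real \<Rightarrow> 'a measure measure \<Rightarrow> 'a measure \<Rightarrow> ennreal" where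
  "J \<Omega> \<kappa> \<Lambda> \<nu> = (\<integral>\<^sup>+ \<mu>. HK_sq \<Omega> \<kappa> \<mu> \<nu> \<partial>\<Lambda>)"

section \<open>Basic facts\<close>

lemma space_borel_of [simp]: "space (borel_of X) = topspace X"
  unfolding borel_of_def by (rule space_measure_of) (auto dest: openin_subset)

lemma sets_borel_of: "sets (borel_of X) = sigma_sets (topspace X) {U. openin X U}"
  unfolding borel_of_def by (rule sets_measure_of) (auto dest: openin_subset)

lemma sets_borel_of_top_of_set:
  "sets (borel_of (top_of_set S)) = sets (restrict_space borel S)"
proof -
  have *: "{A \<inter> S |A. open A} = {U. openin (top_of_set S) U}"
    by (auto simp: openin_open)
  have "sets (restrict_space (borel :: 'a measure) S) = sets (sigma S {A \<inter> S |A. open A})"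
    unfolding borel_def
    by (subst restrict_space_eq_vimage_algebra, simp, subst vimage_algebra_sigma) auto
  also have "\<dots> = sets (borel_of (top_of_set S))"
    unfolding borel_of_def * by simp
  finally show ?thesis by simp
qed

lemma topspace_weak_star [simp]: "topspace (weak_star X) = finite_borel_measures X"
proof -
  have "finite_borel_measures X \<in> {{\<mu> \<in> finite_borel_measures X. (\<integral>x. f x \<partial>\<mu>) \<in> U} | f U.
        continuous_map X euclideanreal f \<and> open U}"
    by (rule CollectI, rule exI[of _ "\<lambda>_. 0"], rule exI[of _ UNIV]) auto
  then show ?thesis unfolding weak_star_def topology_generated_by_topspace by blast
qed

lemma topspace_mass_bounded [simp]:
  "topspace (mass_bounded \<Omega> M) = {\<mu> \<in> Mplus \<Omega>. measure \<mu> \<Omega> \<le> M}"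
  by (auto simp: mass_bounded_def)

lemma limitin_weak_star:
  assumes "\<And>n. \<mu> n \<in> finite_borel_measures X" "\<mu>' \<in> finite_borel_measures X"
  shows "limitin (weak_star X) \<mu> \<mu>' F \<longleftrightarrow>
    (\<forall>f. continuous_map X euclideanreal f \<longrightarrow> ((\<lambda>n. \<integral>x. f x \<partial>\<mu> n) \<longlongrightarrow> (\<integral>x. f x \<partial>\<mu>')) F)"
proof safe
  fix f assume L: "limitin (weak_star X) \<mu> \<mu>' F" and f: "continuous_map X euclideanreal f"
  show "((\<lambda>n. \<integral>x. f x \<partial>\<mu> n) \<longlongrightarrow> (\<integral>x. f x \<partial>\<mu>')) F"
  proof (rule topological_tendstoI)
    fix U :: "real set" assume "open U" and m: "(\<integral>x. f x \<partial>\<mu>') \<in> U"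
    then have "openin (weak_star X) {\<mu> \<in> finite_borel_measures X. (\<integral>x. f x \<partial>\<mu>) \<in> U}"
      unfolding weak_star_def using f by (intro topology_generated_by_Basis) blast
    with L assms(2) m
    have "eventually (\<lambda>n. \<mu> n \<in> {\<mu> \<in> finite_borel_measures X. (\<integral>x. f x \<partial>\<mu>) \<in> U}) F"
      unfolding limitin_def by blast
    then show "eventually (\<lambda>n. (\<integral>x. f x \<partial>\<mu> n) \<in> U) F"
      by (rule eventually_mono) simp
  qed
next
  assume R: "\<forall>f. continuous_map X euclideanreal f \<longrightarrow>
    ((\<lambda>n. \<integral>x. f x \<partial>\<mu> n) \<longlongrightarrow> (\<integral>x. f x \<partial>\<mu>')) F"
  have "eventually (\<lambda>n. \<mu> n \<in> V) F" if "openin (weak_star X) V" "\<mu>' \<in> V" for V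
    using openin_topology_generated_by[OF that(1)[unfolded weak_star_def]] that(2)
  proof induction
    case (Int a b)
    then show ?case by (auto intro: eventually_conj)
  next
    case (UN K)
    then obtain k where k: "k \<in> K" "\<mu>' \<in> k" by blast
    with UN have "eventually (\<lambda>n. \<mu> n \<in> k) F" by blast
    with k(1) show ?case by (auto elim: eventually_mono)
  next
    case (Basis s)
    then obtain f U where fU: "continuous_map X euclideanreal f" "open U"
      "s = {\<mu> \<in> finite_borel_measures X. (\<integral>x. f x \<partial>\<mu>) \<in> U}" by blast
    with R Basis have "eventually (\<lambda>n. (\<integral>x. f x \<partial>\<mu> n) \<in> U) F"
      by (auto dest: topological_tendstoD)
    with assms(1) fU(3) show ?case by simp
  qed auto
  then show "limitin (weak_star X) \<mu> \<mu>' F" using assms(2) by (simp add: limitin_def)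
qed

text \<open>The plan \<open>\<gamma> = 0\<close> shows that \<open>HK_sq\<close> is finite, so its values, and those of \<open>J\<close> for \<open>\<Lambda>\<close> a
  probability measure on \<open>mass_bounded \<Omega> M\<close>, are real numbers inside \<open>ennreal\<close>.\<close>

lemma KL_null:
  assumes "finite_measure \<nu>" "sets \<mu> = sets \<nu>" "\<And>A. emeasure \<mu> A = 0"
  shows "KL \<mu> \<nu> = emeasure \<nu> (space \<nu>)"
proof -
  interpret finite_measure \<nu> by fact
  have ac: "absolutely_continuous \<nu> \<mu>"
    using assms by (auto simp: absolutely_continuous_def null_sets_def)
  have "density \<nu> (\<lambda>_. 0) = \<mu>"
    using assms by (intro measure_eqI) (auto simp: emeasure_density)
  then have "AE x in \<nu>. 0 = RN_deriv \<nu> \<mu> x"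
    by (intro RN_deriv_unique) auto
  then have "(\<integral>\<^sup>+ x. ennreal (kl_phi (enn2real (RN_deriv \<nu> \<mu> x))) \<partial>\<nu>) = (\<integral>\<^sup>+ x. 1 \<partial>\<nu>)"
    by (intro nn_integral_cong_AE) (auto simp: kl_phi_def)
  with ac show ?thesis by (simp add: KL_def)
qed

lemma HK_sq_le:
  assumes "\<mu> \<in> Mplus \<Omega>" "\<nu> \<in> Mplus \<Omega>"
  shows "HK_sq \<Omega> \<kappa> \<mu> \<nu> \<le> emeasure \<mu> \<Omega> + emeasure \<nu> \<Omega>"
proof -
  define \<gamma> :: "('a \<times> 'a) measure" where "\<gamma> = null_measure (borel_of (top_of_set (\<Omega> \<times> \<Omega>)))"
  have g: "\<gamma> \<in> Mplus (\<Omega> \<times> \<Omega>)"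
    by (auto simp: \<gamma>_def finite_borel_measures_def intro!: finite_measureI)
  have z: "emeasure (distr \<gamma> N f) A = 0" for N :: "'a measure" and f A
    by (cases "A \<in> sets N \<and> f \<in> measurable \<gamma> N")
       (auto simp: \<gamma>_def distr_def emeasure_distr emeasure_notin_sets emeasure_measure_of_conv)
  have sp: "space \<mu> = \<Omega>" "space \<nu> = \<Omega>"
    using assms by (auto simp: finite_borel_measures_def dest!: sets_eq_imp_space_eq)
  have "KL (distr \<gamma> (borel_of (top_of_set \<Omega>)) fst) \<mu> = emeasure \<mu> \<Omega>"
    using assms z by (subst KL_null) (auto simp: finite_borel_measures_def sp)
  moreover have "KL (distr \<gamma> (borel_of (top_of_set \<Omega>)) snd) \<nu> = emeasure \<nu> \<Omega>"
    using assms z by (subst KL_null) (auto simp: finite_borel_measures_def sp)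
  moreover have "(\<integral>\<^sup>+ (x, y). hk_cost \<kappa> x y \<partial>\<gamma>) = 0"
  proof -
    have "AE z in \<gamma>. False" by (rule AE_I[where N="space \<gamma>"], auto)
        (simp add: \<gamma>_def)
    then have "(\<integral>\<^sup>+ (x, y). hk_cost \<kappa> x y \<partial>\<gamma>) = (\<integral>\<^sup>+ z. 0 \<partial>\<gamma>)"
      by (intro nn_integral_cong_AE) auto
    then show ?thesis by simp
  qed
  ultimately show ?thesis unfolding HK_sq_def
    by (intro INF_lower2[OF g]) simp
qed

end

theory Submission
  imports Defs
begin

text \<open>
  The stability of \<open>HK_sq\<close> under weak* perturbation of one argument is proved directly from the primal
  problem, without the triangle inequality or duality. Transporting mass at cost above \<open>- 2 ln t\<close>
  never pays by more than \<open>t\<close> times the total mass, so the cost may be replaced by a continuous one.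
  Given a plan for \<open>(\<mu>, \<nu>)\<close> and a fine partition of unity \<open>f\<^sub>i\<close>, the mass arriving in the support of
  \<open>f\<^sub>i\<close> is redistributed proportionally to \<open>f\<^sub>i \<nu>'\<close>. The transport cost changes by the modulus of
  continuity, and the entropy is controlled by finitely many integrals of the \<open>f\<^sub>i\<close>. The resulting
  bound is uniform in \<open>\<mu>\<close> of bounded mass: in the second argument it gives uniform convergence
  of the integrands, and by symmetry it gives weak* continuity in the first.
\<close>

section \<open>The entropy functional\<close>

text \<open>A measure \<nu>' close to \<nu> may be singular to it, so a plan for \<nu> can have
  infinite entropy against \<nu>' and cannot itself serve as a competitor. Averaging inside cells
  with the kernel \<open>k y y' = (\<Sum>i\<in>T. f i y * f i y' / b i)\<close> gives the new second
  marginal a density with respect to \<nu>', namely a mixture of the ratios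
  \<open>q i = s i / b i\<close> of the mass delivered to a cell to its \<nu>'-mass. By Jensen the
  new entropy sees only these ratios, while convex duality bounds the old entropy from below cell by
  cell.

  The estimate is needed in both directions between \<nu> and \<nu>'. A cell that \<nu> does not
  charge may still carry a little \<nu>'-mass, and on the way from \<nu>' to \<nu> what arrives
  there has no target. This is why mass must be dropped, at a price that only a truncated logarithm
  keeps bounded.

  The mass of a plan is bounded only through its energy, so the error comes out multiplicative in
  the energy. It becomes additive because \<open>HK_sq\<close> is at most the sum of the two
  masses.\<close>

lemma kl_phi_fenchel:
  assumes "0 \<le> r"
  shows "l * r - exp l + 1 \<le> kl_phi r"
proof (cases "r = 0")
  case False
  with assms have r: "r > 0" by simp
  \<comment> \<open>The claimed lower bound is the tangent of \<open>kl_phi\<close> at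
    \<open>exp l\<close>. It is \<open>1 + z \<le> exp z\<close> at \<open>z = l - ln r\<close>,
    scaled by \<open>r\<close>.\<close>
  have "1 + (l - ln r) \<le> exp (l - ln r)" by (rule exp_ge_add_one_self)
  then have "r * (1 + (l - ln r)) \<le> r * exp (l - ln r)" using r by (intro mult_left_mono) auto
  also have "r * exp (l - ln r) = exp l" using r by (simp add: exp_diff)
  finally show ?thesis using r by (simp add: kl_phi_def algebra_simps)
qed (simp add: kl_phi_def)

lemma kl_phi_nonneg: "0 \<le> r \<Longrightarrow> 0 \<le> kl_phi r"
  using kl_phi_fenchel[of r 0] by simp

text \<open>The slope \<open>ln s\<close> of \<open>kl_phi\<close> is unbounded below near 0, so
  removing mass can raise the entropy at an arbitrary rate. Above \<open>t\<close> the slope is at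
  least \<open>ln t\<close>, and the tangent at \<open>s\<close> suffices. Below \<open>t\<close>
  the tangent at \<open>t\<close> is used instead, and the additive \<open>t\<close> pays for the
  difference.\<close>

lemma kl_phi_drop:
  assumes "0 \<le> s" "0 \<le> u" "0 < t"
  shows "kl_phi s \<le> kl_phi (s + u) + t - ln t * u"
proof (cases "s < t")
  case True
  have "ln t * (s + u) - t + 1 \<le> kl_phi (s + u)"
    using kl_phi_fenchel[of "s + u" "ln t"] assms by simp
  moreover have "kl_phi s \<le> s * ln t + 1"
  proof (cases "s = 0")
    case False
    with assms True have "s * ln s \<le> s * ln t" by (intro mult_left_mono) auto
    moreover have "kl_phi s = s * ln s - s + 1" using False assms(1) by (simp add: kl_phi_def)
    ultimately show ?thesis using assms(1) by linarith
  qed (simp add: kl_phi_def)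
  ultimately show ?thesis by (simp add: algebra_simps)
next
  case False
  with assms have s: "s > 0" by simp
  have "ln s * (s + u) - s + 1 \<le> kl_phi (s + u)"
    using kl_phi_fenchel[of "s + u" "ln s"] assms s by simp
  moreover have "ln t * u \<le> ln s * u" using False assms s by (intro mult_right_mono) auto
  ultimately show ?thesis using s assms(3) by (simp add: kl_phi_def algebra_simps)
qed

text \<open>Jensen's inequality by averaging the tangent at the mean \<open>m\<close>. The case
  \<open>m = 0\<close> is separate because the slope there is infinite; then every
  \<open>q i\<close> of positive weight vanishes.\<close>

lemma kl_phi_convex_sum:
  assumes "finite T" "\<And>i. i \<in> T \<Longrightarrow> 0 \<le> w i" "\<And>i. i \<in> T \<Longrightarrow> 0 \<le> q i" "sum w T = 1"
  shows "kl_phi (\<Sum>i\<in>T. w i * q i) \<le> (\<Sum>i\<in>T. w i * kl_phi (q i))"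
proof -
  define m where "m = (\<Sum>i\<in>T. w i * q i)"
  have m0: "0 \<le> m" unfolding m_def using assms by (intro sum_nonneg mult_nonneg_nonneg) auto
  show ?thesis
  proof (cases "m = 0")
    case True
    then have z: "w i * q i = 0" if "i \<in> T" for i
      using assms that unfolding m_def by (subst (asm) sum_nonneg_eq_0_iff) auto
    have "(\<Sum>i\<in>T. w i * kl_phi (q i)) = (\<Sum>i\<in>T. w i)"
    proof (rule sum.cong[OF refl])
      fix i assume "i \<in> T"
      with z[of i] show "w i * kl_phi (q i) = w i" by (cases "w i = 0") (auto simp: kl_phi_def)
    qed
    with assms True show ?thesis by (simp add: m_def[symmetric] kl_phi_def)
  next
    case False
    with m0 have m: "m > 0" by simp
    have "kl_phi m = ln m * (\<Sum>i\<in>T. w i * q i) + (1 - m) * (\<Sum>i\<in>T. w i)"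
      using m unfolding assms(4) m_def[symmetric] by (simp add: kl_phi_def)
    also have "\<dots> = (\<Sum>i\<in>T. w i * (ln m * q i - exp (ln m) + 1))"
      using m by (simp add: sum_distrib_left sum.distrib[symmetric] algebra_simps)
    also have "\<dots> \<le> (\<Sum>i\<in>T. w i * kl_phi (q i))"
      using assms by (intro sum_mono mult_left_mono kl_phi_fenchel) auto
    finally show ?thesis by (simp add: m_def)
  qed
qed

lemma kl_phi_measurable [measurable]: "kl_phi \<in> borel_measurable borel"
  unfolding kl_phi_def[abs_def] by measurable

section \<open>Divergence expressed through real densities\<close>

lemma KL_density:
  assumes "finite_measure \<nu>" and [measurable]: "g \<in> borel_measurable \<nu>"
    and "\<And>x. x \<in> space \<nu> \<Longrightarrow> 0 \<le> g x"
  shows "KL (density \<nu> (\<lambda>x. ennreal (g x))) \<nu> = (\<integral>\<^sup>+ x. ennreal (kl_phi (g x)) \<partial>\<nu>)"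
proof -
  interpret finite_measure \<nu> by fact
  have "AE x in \<nu>. ennreal (g x) = RN_deriv \<nu> (density \<nu> (\<lambda>x. ennreal (g x))) x"
    by (intro RN_deriv_unique) auto
  then have "AE x in \<nu>. g x = enn2real (RN_deriv \<nu> (density \<nu> (\<lambda>x. ennreal (g x))) x)"
    using AE_space
  proof eventually_elim
    case (elim x)
    from elim(1)[symmetric] show ?case using assms(3)[OF elim(2)] by simp
  qed
  then have "(\<integral>\<^sup>+ x. ennreal (kl_phi (enn2real (RN_deriv \<nu> (density \<nu> (\<lambda>x. ennreal (g x))) x))) \<partial>\<nu>)
      = (\<integral>\<^sup>+ x. ennreal (kl_phi (g x)) \<partial>\<nu>)"
    by (intro nn_integral_cong_AE) auto
  moreover have "absolutely_continuous \<nu> (density \<nu> (\<lambda>x. ennreal (g x)))"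
    by (intro absolutely_continuousI_density) auto
  ultimately show ?thesis by (simp add: KL_def)
qed

lemma absolutely_continuous_density_real:
  assumes "finite_measure \<nu>" "finite_measure \<sigma>" "sets \<sigma> = sets \<nu>" "absolutely_continuous \<nu> \<sigma>"
  obtains g where "g \<in> borel_measurable \<nu>" "\<And>x. 0 \<le> g x" "\<sigma> = density \<nu> (\<lambda>x. ennreal (g x))"
proof -
  interpret finite_measure \<nu> by fact
  obtain D where D: "D \<in> borel_measurable \<nu>" "AE x in \<nu>. RN_deriv \<nu> \<sigma> x = ennreal (D x)" "\<And>x. 0 \<le> D x"
    using real_RN_deriv[OF assms(2,4,3)] by metis
  have "\<sigma> = density \<nu> (RN_deriv \<nu> \<sigma>)" using assms by (intro density_RN_deriv[symmetric]) auto
  also have "\<dots> = density \<nu> (\<lambda>x. ennreal (D x))"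
    using D by (intro density_cong) auto
  finally show ?thesis using that D by blast
qed

text \<open>This bounds the price of removing the part \<open>\<tau>\<close> of a marginal \<open>\<rho>\<close>; the free parameter \<open>t\<close> is
  matched with the truncation level of the cost.\<close>

lemma KL_drop:
  assumes "finite_measure \<nu>" "finite_measure \<sigma>" "finite_measure \<tau>"
    and sets: "sets \<sigma> = sets \<nu>" "sets \<tau> = sets \<nu>" "sets \<rho> = sets \<nu>"
    and sum: "\<And>A. A \<in> sets \<nu> \<Longrightarrow> emeasure \<rho> A = emeasure \<sigma> A + emeasure \<tau> A"
    and t: "0 < t" "t \<le> 1"
  shows "KL \<sigma> \<nu> \<le> KL \<rho> \<nu> + ennreal t * emeasure \<nu> (space \<nu>) + ennreal (- ln t) * emeasure \<tau> (space \<nu>)"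
proof (cases "absolutely_continuous \<nu> \<rho>")
  case False
  then show ?thesis by (simp add: KL_def)
next
  case True
  have "absolutely_continuous \<nu> \<sigma>" "absolutely_continuous \<nu> \<tau>"
    using True sum sets by (auto simp: absolutely_continuous_def null_sets_def)
  then obtain s u where su: "s \<in> borel_measurable \<nu>" "\<And>x. 0 \<le> s x" "\<sigma> = density \<nu> (\<lambda>x. ennreal (s x))"
    "u \<in> borel_measurable \<nu>" "\<And>x. 0 \<le> u x" "\<tau> = density \<nu> (\<lambda>x. ennreal (u x))"
    using absolutely_continuous_density_real[OF assms(1,2) sets(1)]
      absolutely_continuous_density_real[OF assms(1,3) sets(2)] by metis
  note [measurable] = su(1,4)
  have \<rho>: "\<rho> = density \<nu> (\<lambda>x. ennreal (s x + u x))"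
    using sets su sum
    by (intro measure_eqI) (auto simp: emeasure_density nn_integral_add[symmetric] distrib_right)
  have "KL \<sigma> \<nu> = (\<integral>\<^sup>+ x. ennreal (kl_phi (s x)) \<partial>\<nu>)"
    unfolding su(3) by (intro KL_density assms su)
  also have "\<dots> \<le> (\<integral>\<^sup>+ x. ennreal (kl_phi (s x + u x)) + ennreal t + ennreal (- ln t) * ennreal (u x) \<partial>\<nu>)"
  proof (intro nn_integral_mono)
    fix x
    have "kl_phi (s x) \<le> kl_phi (s x + u x) + t + (- ln t) * u x"
      using kl_phi_drop[of "s x" "u x" t] su t by simp
    then have "ennreal (kl_phi (s x)) \<le> ennreal (kl_phi (s x + u x) + t + (- ln t) * u x)"
      by (rule ennreal_leI)
    also have "\<dots> = ennreal (kl_phi (s x + u x)) + ennreal t + ennreal (- ln t) * ennreal (u x)"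
      using su(2,5) t kl_phi_nonneg[of "s x + u x"]
      by (subst ennreal_mult[symmetric]) (auto simp: ennreal_plus[symmetric] mult_nonpos_nonneg simp del: ennreal_plus)
    finally show "ennreal (kl_phi (s x)) \<le> ennreal (kl_phi (s x + u x)) + ennreal t + ennreal (- ln t) * ennreal (u x)" .
  qed
  also have "\<dots> = (\<integral>\<^sup>+ x. ennreal (kl_phi (s x + u x)) \<partial>\<nu>) + ennreal t * emeasure \<nu> (space \<nu>)
      + ennreal (- ln t) * (\<integral>\<^sup>+ x. ennreal (u x) \<partial>\<nu>)"
    by (simp add: nn_integral_add nn_integral_cmult)
  also have "(\<integral>\<^sup>+ x. ennreal (kl_phi (s x + u x)) \<partial>\<nu>) = KL \<rho> \<nu>"
    unfolding \<rho> using su by (intro KL_density[symmetric] assms) auto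
  also have "(\<integral>\<^sup>+ x. ennreal (u x) \<partial>\<nu>) = emeasure \<tau> (space \<nu>)"
    unfolding su(6) by (simp add: emeasure_density cong: nn_integral_cong)
  finally show ?thesis .
qed

section \<open>Measurability on subsets of a Euclidean space\<close>

lemma Mplus_sets: "\<mu> \<in> Mplus \<Omega> \<Longrightarrow> sets \<mu> = sets (restrict_space borel \<Omega>)"
  by (simp add: finite_borel_measures_def sets_borel_of_top_of_set)

lemma Mplus_space: "\<mu> \<in> Mplus \<Omega> \<Longrightarrow> space \<mu> = \<Omega>"
  using sets_eq_imp_space_eq[OF Mplus_sets] by (simp add: space_restrict_space)

lemma Mplus_finite: "\<mu> \<in> Mplus \<Omega> \<Longrightarrow> finite_measure \<mu>"
  by (simp add: finite_borel_measures_def)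

lemma borel_of_cong: "measurable M (borel_of (top_of_set S)) = measurable M (restrict_space borel S)"
   "measurable (borel_of (top_of_set S)) M = measurable (restrict_space borel S) M"
  by (auto intro!: measurable_cong_sets sets_borel_of_top_of_set)

lemma measurable_restrict_Times:
  fixes S :: "'a::euclidean_space set" and T :: "'b::euclidean_space set"
  shows "fst \<in> measurable (restrict_space borel (S \<times> T)) (restrict_space borel S)"
   and "snd \<in> measurable (restrict_space borel (S \<times> T)) (restrict_space borel T)"
proof -
  have "fst \<in> measurable (restrict_space borel (S \<times> T)) borel"
    "snd \<in> measurable (restrict_space borel (S \<times> T)) borel"
    unfolding borel_prod[symmetric] by (intro measurable_restrict_space1 measurable_fst measurable_snd)+
  then show "fst \<in> measurable (restrict_space borel (S \<times> T)) (restrict_space borel S)"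
   and "snd \<in> measurable (restrict_space borel (S \<times> T)) (restrict_space borel T)"
    by (auto intro!: measurable_restrict_space2 simp: space_restrict_space)
qed

lemma measurable_Pair_restrict:
  fixes S :: "'a::euclidean_space set" and T :: "'b::euclidean_space set"
  assumes "f \<in> measurable N (restrict_space borel S)" "g \<in> measurable N (restrict_space borel T)"
  shows "(\<lambda>x. (f x, g x)) \<in> measurable N (restrict_space borel (S \<times> T))"
proof -
  have fg: "f \<in> borel_measurable N" "g \<in> borel_measurable N"
    "f \<in> space N \<rightarrow> S" "g \<in> space N \<rightarrow> T"
    using assms unfolding measurable_restrict_space2_iff by simp_all
  then have "(\<lambda>x. (f x, g x)) \<in> measurable N (borel \<Otimes>\<^sub>M borel)" by measurable
  with fg show ?thesis
    unfolding borel_prod by (intro measurable_restrict_space2) auto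
qed

section \<open>Plans and truncation of the cost\<close>

text \<open>The cost is a parameter so that the true and the truncated problem share one functional:
  stability is proved for the latter and transferred to the former.\<close>

definition HK_energy :: "'a::euclidean_space set \<Rightarrow> ('a \<Rightarrow> 'a \<Rightarrow> ennreal) \<Rightarrow> 'a measure \<Rightarrow> 'a measure \<Rightarrow> ('a \<times> 'a) measure \<Rightarrow> ennreal" where
  "HK_energy \<Omega> c \<mu> \<nu> \<gamma> = (\<integral>\<^sup>+ (x, y). c x y \<partial>\<gamma>)
     + KL (distr \<gamma> (borel_of (top_of_set \<Omega>)) fst) \<mu>
     + KL (distr \<gamma> (borel_of (top_of_set \<Omega>)) snd) \<nu>"

definition HK_fun :: "'a::euclidean_space set \<Rightarrow> ('a \<Rightarrow> 'a \<Rightarrow> ennreal) \<Rightarrow> 'a measure \<Rightarrow> 'a measure \<Rightarrow> ennreal" where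
  "HK_fun \<Omega> c \<mu> \<nu> = (INF \<gamma> \<in> Mplus (\<Omega> \<times> \<Omega>). HK_energy \<Omega> c \<mu> \<nu> \<gamma>)"

lemma HK_sq_eq_HK_fun: "HK_sq \<Omega> \<kappa> = HK_fun \<Omega> (hk_cost \<kappa>)"
  by (simp add: HK_sq_def HK_fun_def HK_energy_def fun_eq_iff)

lemma HK_fun_mono:
  assumes "\<And>x y. c x y \<le> c' x y"
  shows "HK_fun \<Omega> c \<mu> \<nu> \<le> HK_fun \<Omega> c' \<mu> \<nu>"
  unfolding HK_fun_def HK_energy_def using assms
  by (intro INF_mono' add_mono nn_integral_mono order_refl) auto

text \<open>Carries a bound valid for every plan over to the infimum, so that no minimiser has to
  exist. Only a finite infimum needs an argument, and there an index within \<open>e / C\<close> of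
  it costs exactly \<open>e\<close> after scaling by \<open>C\<close>.\<close>

lemma le_INF_affine_ennreal:
  fixes f :: "'i \<Rightarrow> ennreal"
  assumes "\<And>i. i \<in> I \<Longrightarrow> a \<le> ennreal C * f i + R" "0 < C"
  shows "a \<le> ennreal C * (INF i\<in>I. f i) + R"
proof (rule ennreal_le_epsilon)
  fix e :: real assume fin: "ennreal C * (INF i\<in>I. f i) + R < top" and e: "0 < e"
  from fin assms(2) have "(INF i\<in>I. f i) < top" by (auto simp: ennreal_mult_less_top)
  then obtain m where m: "(INF i\<in>I. f i) = ennreal m" "0 \<le> m"
    by (cases "INF i\<in>I. f i" rule: ennreal_cases) auto
  have "(INF i\<in>I. f i) < (INF i\<in>I. f i) + ennreal (e / C)"
    unfolding m(1) using m(2) e assms(2) by (simp add: ennreal_plus[symmetric] ennreal_less_iff del: ennreal_plus)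
  then obtain i where i: "i \<in> I" "f i < (INF i\<in>I. f i) + ennreal (e / C)"
    unfolding INF_less_iff by blast
  have "a \<le> ennreal C * f i + R" using assms i by blast
  also have "\<dots> \<le> ennreal C * ((INF i\<in>I. f i) + ennreal (e / C)) + R"
    using i by (intro add_right_mono mult_left_mono) auto
  also have "\<dots> = ennreal C * (INF i\<in>I. f i) + R + ennreal e"
    using e assms(2) by (simp add: distrib_left ennreal_mult[symmetric] add_ac)
  finally show "a \<le> ennreal C * (INF i\<in>I. f i) + R + ennreal e" .
qed

section \<open>The transport cost and the symmetry of the distance\<close>

lemma hk_cost_measurable [measurable]:
  "(\<lambda>z. hk_cost \<kappa> (fst z) (snd z)) \<in> borel_measurable (borel :: ('a::euclidean_space \<times> 'a) measure)"
  unfolding hk_cost_def borel_prod[symmetric] by measurable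

lemma hk_cost_sym: "hk_cost \<kappa> x y = hk_cost \<kappa> y x"
  by (simp add: hk_cost_def norm_minus_commute)

text \<open>Pushing a plan forward under the swap of coordinates exchanges its marginals and keeps
  its cost. One inequality for all pairs then gives equality. Symmetry later turns stability in the
  second argument into continuity in the first.\<close>

lemma HK_sq_sym:
  fixes \<Omega> :: "'a::euclidean_space set"
  shows "HK_sq \<Omega> \<kappa> \<mu> \<nu> = HK_sq \<Omega> \<kappa> \<nu> \<mu>"
proof -
  have "HK_fun \<Omega> (hk_cost \<kappa>) \<mu> \<nu> \<le> HK_fun \<Omega> (hk_cost \<kappa>) \<nu> \<mu>" for \<mu> \<nu>
    unfolding HK_fun_def
  proof (rule INF_mono)
    fix \<gamma> :: "('a \<times> 'a) measure" assume \<gamma>: "\<gamma> \<in> Mplus (\<Omega> \<times> \<Omega>)"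
    let ?XX = "restrict_space borel (\<Omega> \<times> \<Omega>) :: ('a \<times> 'a) measure"
    let ?X = "borel_of (top_of_set \<Omega>)"
    have ms: "measurable \<gamma> N = measurable ?XX N" for N :: "'a measure"
      using Mplus_sets[OF \<gamma>] by (rule measurable_cong_sets) simp
    have sw: "(\<lambda>z. (snd z, fst z)) \<in> measurable \<gamma> ?XX"
      by (intro measurable_Pair_restrict) (simp_all add: ms measurable_restrict_Times)
    define \<gamma>' where "\<gamma>' = distr \<gamma> ?XX (\<lambda>z. (snd z, fst z))"
    interpret \<gamma>: finite_measure \<gamma> by (rule Mplus_finite[OF \<gamma>])
    have "\<gamma>' \<in> Mplus (\<Omega> \<times> \<Omega>)"
      unfolding \<gamma>'_def finite_borel_measures_def using sw
      by (auto simp: sets_borel_of_top_of_set intro!: \<gamma>.finite_measure_distr)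
    moreover have "distr \<gamma>' ?X fst = distr \<gamma> ?X snd" "distr \<gamma>' ?X snd = distr \<gamma> ?X fst"
      unfolding \<gamma>'_def using sw
      by (subst distr_distr; simp add: borel_of_cong measurable_restrict_Times o_def cong: distr_cong)+
    moreover have "(\<integral>\<^sup>+ (x, y). hk_cost \<kappa> x y \<partial>\<gamma>') = (\<integral>\<^sup>+ (x, y). hk_cost \<kappa> x y \<partial>\<gamma>)"
      unfolding \<gamma>'_def case_prod_beta using sw
      by (subst nn_integral_distr) (auto intro: measurable_restrict_space1 simp: hk_cost_sym)
    ultimately show "\<exists>\<gamma>'\<in>Mplus (\<Omega> \<times> \<Omega>). HK_energy \<Omega> (hk_cost \<kappa>) \<mu> \<nu> \<gamma>' \<le> HK_energy \<Omega> (hk_cost \<kappa>) \<nu> \<mu> \<gamma>"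
      by (intro bexI[of _ \<gamma>']) (auto simp: HK_energy_def add_ac)
  qed
  then show ?thesis by (simp add: HK_sq_eq_HK_fun antisym)
qed

text \<open>For \<open>0 < t \<le> 1\<close> and \<open>0 < \<kappa>\<close> this is the minimum of
  the true cost and \<open>- 2 * ln t\<close>. The cap at \<open>pi / 2\<close> is there because the
  cosine becomes positive again at larger angles; the \<open>max\<close> keeps the logarithm finite,
  hence the cost continuous.\<close>

definition trunc_cost :: "real \<Rightarrow> real \<Rightarrow> 'a::euclidean_space \<Rightarrow> 'a \<Rightarrow> real" where
  "trunc_cost \<kappa> t x y = - 2 * ln (max t (cos (min (norm (x - y) / \<kappa>) (pi / 2))))"

lemma trunc_cost_nonneg: "0 < t \<Longrightarrow> t \<le> 1 \<Longrightarrow> 0 \<le> trunc_cost \<kappa> t x y"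
  by (auto simp: trunc_cost_def)

lemma trunc_cost_cases:
  assumes "0 < t" "t \<le> 1" "0 < \<kappa>"
  shows "norm (x - y) < \<kappa> * pi / 2 \<and> t \<le> cos (norm (x - y) / \<kappa>)
      \<Longrightarrow> hk_cost \<kappa> x y = ennreal (trunc_cost \<kappa> t x y)"
    and "\<not> (norm (x - y) < \<kappa> * pi / 2 \<and> t \<le> cos (norm (x - y) / \<kappa>))
      \<Longrightarrow> trunc_cost \<kappa> t x y = - 2 * ln t"
proof -
  have lt: "norm (x - y) < \<kappa> * pi / 2 \<longleftrightarrow> norm (x - y) / \<kappa> < pi / 2"
    using assms by (simp add: field_simps)
  show "norm (x - y) < \<kappa> * pi / 2 \<and> t \<le> cos (norm (x - y) / \<kappa>)
      \<Longrightarrow> hk_cost \<kappa> x y = ennreal (trunc_cost \<kappa> t x y)"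
    unfolding hk_cost_def trunc_cost_def lt by (simp add: min_absorb1 max_absorb2 del: times_divide_eq_right)
  assume "\<not> (norm (x - y) < \<kappa> * pi / 2 \<and> t \<le> cos (norm (x - y) / \<kappa>))"
  then consider "pi / 2 \<le> norm (x - y) / \<kappa>" |
      "norm (x - y) / \<kappa> < pi / 2" "cos (norm (x - y) / \<kappa>) < t"
    unfolding lt by linarith
  then show "trunc_cost \<kappa> t x y = - 2 * ln t"
  proof cases
    case 1
    then have "min (norm (x - y) / \<kappa>) (pi / 2) = pi / 2" by simp
    with assms show ?thesis unfolding trunc_cost_def by (simp only:) simp
  next
    case 2
    then show ?thesis by (simp add: trunc_cost_def)
  qed
qed

lemma trunc_cost_le_hk_cost:
  assumes "0 < t" "t \<le> 1" "0 < \<kappa>"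
  shows "ennreal (trunc_cost \<kappa> t x y) \<le> hk_cost \<kappa> x y"
proof (cases "norm (x - y) < \<kappa> * pi / 2")
  case True
  with assms have "norm (x - y) / \<kappa> < pi / 2" by (simp add: field_simps)
  moreover from this have "cos (norm (x - y) / \<kappa>) > 0"
    using assms by (intro cos_gt_zero_pi) (auto intro: less_le_trans[of _ 0])
  ultimately show ?thesis using assms True
    by (auto simp: hk_cost_def trunc_cost_def intro!: ennreal_leI)
qed (simp add: hk_cost_def)

lemma trunc_cost_continuous:
  "0 < t \<Longrightarrow> 0 < \<kappa> \<Longrightarrow> continuous_on S (\<lambda>z. trunc_cost \<kappa> t (fst z) (snd z))"
  unfolding trunc_cost_def
  by (intro continuous_intros) (auto simp: max_def)

lemma trunc_cost_measurable:
  "(\<lambda>z. trunc_cost \<kappa> t (fst z) (snd z)) \<in> borel_measurable (borel :: ('a::euclidean_space \<times> 'a) measure)"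
  unfolding trunc_cost_def borel_prod[symmetric] by measurable

text \<open>Keep only the part of a plan on the set \<open>S\<close> where both costs agree. Off
  \<open>S\<close> the truncated cost is \<open>- 2 * ln t\<close> per unit of mass, so dropping
  that part saves this amount, while by \<open>KL_drop\<close> each marginal pays at most
  \<open>- ln t\<close> per unit. Only the terms \<open>t\<close> times the masses of \<mu> and
  \<nu> remain.\<close>

lemma HK_sq_le_trunc:
  fixes \<Omega> :: "'a::euclidean_space set"
  assumes \<mu>: "\<mu> \<in> Mplus \<Omega>" and \<nu>: "\<nu> \<in> Mplus \<Omega>" and t: "0 < t" "t \<le> 1" and \<kappa>: "0 < \<kappa>"
  shows "HK_sq \<Omega> \<kappa> \<mu> \<nu> \<le> HK_fun \<Omega> (\<lambda>x y. ennreal (trunc_cost \<kappa> t x y)) \<mu> \<nu>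
    + ennreal t * (emeasure \<mu> \<Omega> + emeasure \<nu> \<Omega>)"
proof -
  define S :: "('a \<times> 'a) set" where
    "S = {z. norm (fst z - snd z) < \<kappa> * pi / 2 \<and> t \<le> cos (norm (fst z - snd z) / \<kappa>)}"
  have "{z \<in> space (borel \<Otimes>\<^sub>M borel). norm (fst z - snd z) < \<kappa> * pi / 2 \<and> t \<le> cos (norm (fst z - snd z) / \<kappa>)}
      \<in> sets (borel \<Otimes>\<^sub>M (borel :: 'a measure))"
    by measurable
  then have S: "S \<in> sets borel"
    unfolding borel_prod by (simp add: S_def)
  let ?X = "borel_of (top_of_set \<Omega>)"
  have "HK_fun \<Omega> (hk_cost \<kappa>) \<mu> \<nu> \<le> ennreal 1 * HK_energy \<Omega> (\<lambda>x y. ennreal (trunc_cost \<kappa> t x y)) \<mu> \<nu> \<gamma>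
     + ennreal t * (emeasure \<mu> \<Omega> + emeasure \<nu> \<Omega>)" if \<gamma>: "\<gamma> \<in> Mplus (\<Omega> \<times> \<Omega>)" for \<gamma>
  proof -
    interpret \<gamma>: finite_measure \<gamma> by (rule Mplus_finite[OF \<gamma>])
    have [measurable]: "fst \<in> measurable \<gamma> ?X" "snd \<in> measurable \<gamma> ?X"
      by (simp_all add: measurable_cong_sets[OF Mplus_sets[OF \<gamma>] refl] borel_of_cong measurable_restrict_Times)
    have bm: "f \<in> borel_measurable \<gamma>" if "f \<in> borel_measurable borel" for f :: "'a \<times> 'a \<Rightarrow> ennreal"
      using measurable_restrict_space1[OF that] by (simp add: measurable_cong_sets[OF Mplus_sets[OF \<gamma>] refl])
    have [measurable]: "(\<lambda>z. indicator S z :: ennreal) \<in> borel_measurable \<gamma>" "(\<lambda>z. indicator (- S) z :: ennreal) \<in> borel_measurable \<gamma>"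
      using S by (auto intro!: bm)
    have [measurable]: "(\<lambda>z. hk_cost \<kappa> (fst z) (snd z)) \<in> borel_measurable \<gamma>"
      "(\<lambda>z. ennreal (trunc_cost \<kappa> t (fst z) (snd z))) \<in> borel_measurable \<gamma>"
      by (intro bm hk_cost_measurable measurable_compose[OF trunc_cost_measurable] measurable_ennreal)+
    define \<gamma>1 where "\<gamma>1 = density \<gamma> (indicator S)"
    define \<gamma>2 where "\<gamma>2 = density \<gamma> (indicator (- S))"
    have sets12 [measurable_cong, simp]: "sets \<gamma>1 = sets \<gamma>" "sets \<gamma>2 = sets \<gamma>"
      by (simp_all add: \<gamma>1_def \<gamma>2_def)
    have sum12: "emeasure \<gamma>1 A + emeasure \<gamma>2 A = emeasure \<gamma> A" if [measurable]: "A \<in> sets \<gamma>" for A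
    proof -
      have "emeasure \<gamma>1 A + emeasure \<gamma>2 A = (\<integral>\<^sup>+ z. indicator S z * indicator A z + indicator (- S) z * indicator A z \<partial>\<gamma>)"
        unfolding \<gamma>1_def \<gamma>2_def by (subst (1 2) emeasure_density) (auto simp: nn_integral_add)
      also have "\<dots> = (\<integral>\<^sup>+ z. indicator A z \<partial>\<gamma>)"
        by (intro nn_integral_cong) (auto simp: indicator_def)
      finally show ?thesis by simp
    qed
    have fin: "emeasure \<gamma>1 (space \<gamma>) \<noteq> top" "emeasure \<gamma>2 (space \<gamma>) \<noteq> top"
      using \<gamma>.emeasure_finite[of "space \<gamma>"] unfolding sum12[OF sets.top, symmetric]
      by (auto simp: ennreal_add_eq_top)
    have sp12: "space \<gamma>1 = space \<gamma>" "space \<gamma>2 = space \<gamma>" by (simp_all add: \<gamma>1_def \<gamma>2_def)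
    interpret \<gamma>1: finite_measure \<gamma>1 by (rule finite_measureI) (simp add: sp12 fin)
    interpret \<gamma>2: finite_measure \<gamma>2 by (rule finite_measureI) (simp add: sp12 fin)
    have \<gamma>1_M: "\<gamma>1 \<in> Mplus (\<Omega> \<times> \<Omega>)"
      using \<gamma> \<gamma>1.finite_measure_axioms by (simp add: finite_borel_measures_def)
    have KL: "KL (distr \<gamma>1 ?X p) \<rho> \<le> KL (distr \<gamma> ?X p) \<rho> + ennreal t * emeasure \<rho> \<Omega> + ennreal (- ln t) * emeasure \<gamma>2 (space \<gamma>)"
      if [measurable]: "p \<in> measurable \<gamma> ?X" and \<rho>: "\<rho> \<in> Mplus \<Omega>" for p \<rho>
    proof -
      have s\<rho>: "sets \<rho> = sets ?X" using \<rho> by (simp add: finite_borel_measures_def)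
      have "KL (distr \<gamma>1 ?X p) \<rho> \<le> KL (distr \<gamma> ?X p) \<rho> + ennreal t * emeasure \<rho> (space \<rho>)
          + ennreal (- ln t) * emeasure (distr \<gamma>2 ?X p) (space \<rho>)"
        using t \<rho> s\<rho> sum12
        by (intro KL_drop) (auto simp: Mplus_finite emeasure_distr sp12 intro!: \<gamma>1.finite_measure_distr \<gamma>2.finite_measure_distr)
      also have "emeasure (distr \<gamma>2 ?X p) (space \<rho>) = emeasure \<gamma>2 (space \<gamma>)"
        using measurable_space[OF that(1)] Mplus_space[OF \<rho>] s\<rho>
        by (subst emeasure_distr) (auto simp: sp12 intro!: arg_cong[where f="emeasure \<gamma>2"] dest: sets_eq_imp_space_eq)
      finally show ?thesis using Mplus_space[OF \<rho>] by simp
    qed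
    define g2 where "g2 = emeasure \<gamma>2 (space \<gamma>)"
    have "(\<integral>\<^sup>+ z. ennreal (trunc_cost \<kappa> t (fst z) (snd z)) \<partial>\<gamma>)
      = (\<integral>\<^sup>+ z. indicator S z * hk_cost \<kappa> (fst z) (snd z) + ennreal (- 2 * ln t) * indicator (- S) z \<partial>\<gamma>)"
    proof (intro nn_integral_cong)
      fix z :: "'a \<times> 'a"
      show "ennreal (trunc_cost \<kappa> t (fst z) (snd z))
        = indicator S z * hk_cost \<kappa> (fst z) (snd z) + ennreal (- 2 * ln t) * indicator (- S) z"
        using trunc_cost_cases[OF t \<kappa>, of "fst z" "snd z"]
        by (cases "z \<in> S") (simp_all add: S_def indicator_def)
    qed
    also have "\<dots> = (\<integral>\<^sup>+ z. hk_cost \<kappa> (fst z) (snd z) \<partial>\<gamma>1) + ennreal (- 2 * ln t) * g2"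
      unfolding g2_def \<gamma>1_def \<gamma>2_def
      by (subst nn_integral_density) (auto simp: nn_integral_add nn_integral_cmult emeasure_density)
    \<comment> \<open>One half of the saving goes to each marginal.\<close>
    also have "ennreal (- 2 * ln t) = ennreal (- ln t) + ennreal (- ln t)"
      using t by (subst ennreal_plus[symmetric]) auto
    finally have cost: "(\<integral>\<^sup>+ z. ennreal (trunc_cost \<kappa> t (fst z) (snd z)) \<partial>\<gamma>)
      = (\<integral>\<^sup>+ z. hk_cost \<kappa> (fst z) (snd z) \<partial>\<gamma>1) + (ennreal (- ln t) + ennreal (- ln t)) * g2" .
    have "HK_fun \<Omega> (hk_cost \<kappa>) \<mu> \<nu> \<le> HK_energy \<Omega> (hk_cost \<kappa>) \<mu> \<nu> \<gamma>1"
      unfolding HK_fun_def by (intro INF_lower \<gamma>1_M)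
    also have "\<dots> \<le> (\<integral>\<^sup>+ z. hk_cost \<kappa> (fst z) (snd z) \<partial>\<gamma>1)
       + (KL (distr \<gamma> ?X fst) \<mu> + ennreal t * emeasure \<mu> \<Omega> + ennreal (- ln t) * g2)
       + (KL (distr \<gamma> ?X snd) \<nu> + ennreal t * emeasure \<nu> \<Omega> + ennreal (- ln t) * g2)"
      unfolding HK_energy_def g2_def case_prod_beta by (intro add_mono order_refl KL \<mu> \<nu>) auto
    also have "\<dots> = HK_energy \<Omega> (\<lambda>x y. ennreal (trunc_cost \<kappa> t x y)) \<mu> \<nu> \<gamma> + ennreal t * (emeasure \<mu> \<Omega> + emeasure \<nu> \<Omega>)"
      unfolding HK_energy_def case_prod_beta cost by (simp add: algebra_simps)
    finally show ?thesis by simp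
  qed
  from le_INF_affine_ennreal[OF this] show ?thesis
    by (simp add: HK_sq_eq_HK_fun HK_fun_def)
qed

section \<open>Stability in the second marginal\<close>

text \<open>The first coordinate stays and the second is resampled from \<nu> with weight
  \<open>k\<close>: reweight the product of \<gamma> and \<nu>, then forget the old second
  coordinate. Nothing normalises \<open>k\<close>, so finiteness of the new measure is left to the
  application.\<close>

lemma plan_kernel:
  fixes \<Omega> :: "'a::euclidean_space set" and k :: "'a \<Rightarrow> 'a \<Rightarrow> real"
  assumes \<gamma>: "\<gamma> \<in> Mplus (\<Omega> \<times> \<Omega>)" and \<nu>: "\<nu> \<in> Mplus \<Omega>"
    and k: "(\<lambda>z. k (fst z) (snd z)) \<in> borel_measurable (restrict_space borel (\<Omega> \<times> \<Omega>))"
  obtains \<gamma>' where "sets \<gamma>' = sets (restrict_space borel (\<Omega> \<times> \<Omega>))"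
    "\<And>h. h \<in> borel_measurable (restrict_space borel (\<Omega> \<times> \<Omega>)) \<Longrightarrow>
      (\<integral>\<^sup>+ z. h z \<partial>\<gamma>') = (\<integral>\<^sup>+ z. (\<integral>\<^sup>+ y'. ennreal (k (snd z) y') * h (fst z, y') \<partial>\<nu>) \<partial>\<gamma>)"
proof -
  let ?XX = "restrict_space borel (\<Omega> \<times> \<Omega>) :: ('a \<times> 'a) measure"
  let ?X = "restrict_space borel \<Omega> :: 'a measure"
  interpret \<nu>: finite_measure \<nu> by (rule Mplus_finite[OF \<nu>])
  note [measurable_cong] = Mplus_sets[OF \<gamma>] Mplus_sets[OF \<nu>]
  note [measurable] = measurable_restrict_Times
  have m1: "(\<lambda>p. (snd (fst p), snd p)) \<in> measurable (\<gamma> \<Otimes>\<^sub>M \<nu>) ?XX"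
    by (rule measurable_Pair_restrict) measurable
  have m2 [measurable]: "(\<lambda>p. (fst (fst p), snd p)) \<in> measurable (\<gamma> \<Otimes>\<^sub>M \<nu>) ?XX"
    by (rule measurable_Pair_restrict) measurable
  have [measurable]: "(\<lambda>p. k (snd (fst p)) (snd p)) \<in> borel_measurable (\<gamma> \<Otimes>\<^sub>M \<nu>)"
    using measurable_compose[OF m1 k] by simp
  define \<gamma>' where "\<gamma>' = distr (density (\<gamma> \<Otimes>\<^sub>M \<nu>) (\<lambda>p. ennreal (k (snd (fst p)) (snd p)))) ?XX (\<lambda>p. (fst (fst p), snd p))"
  show ?thesis
  proof
    show "sets \<gamma>' = sets ?XX" by (simp add: \<gamma>'_def)
    fix h :: "'a \<times> 'a \<Rightarrow> ennreal" assume [measurable]: "h \<in> borel_measurable ?XX"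
    have [measurable]: "(\<lambda>p. h (fst (fst p), snd p)) \<in> borel_measurable (\<gamma> \<Otimes>\<^sub>M \<nu>)"
      by (rule measurable_compose[OF m2]) fact
    have "(\<integral>\<^sup>+ z. h z \<partial>\<gamma>') = (\<integral>\<^sup>+ p. ennreal (k (snd (fst p)) (snd p)) * h (fst (fst p), snd p) \<partial>(\<gamma> \<Otimes>\<^sub>M \<nu>))"
      unfolding \<gamma>'_def by (subst nn_integral_distr) (auto simp: nn_integral_density)
    also have "\<dots> = (\<integral>\<^sup>+ z. (\<integral>\<^sup>+ y'. ennreal (k (snd z) y') * h (fst z, y') \<partial>\<nu>) \<partial>\<gamma>)"
      by (subst \<nu>.nn_integral_fst[symmetric]) auto
    finally show "(\<integral>\<^sup>+ z. h z \<partial>\<gamma>') = (\<integral>\<^sup>+ z. (\<integral>\<^sup>+ y'. ennreal (k (snd z) y') * h (fst z, y') \<partial>\<nu>) \<partial>\<gamma>)" .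
  qed
qed

text \<open>Mass arriving in cells that are empty for the new marginal \<open>\<nu>'\<close> is dropped. What this costs in
  the first marginal, \<open>- ln t\<close> per unit, is gained in the entropy with respect to \<open>\<nu>\<close>, up to
  \<open>1 / t\<close> times the \<open>\<nu>\<close>-mass of those cells.\<close>

lemma HK_fun_stability:
  fixes \<Omega> :: "'a::euclidean_space set" and c :: "'a \<Rightarrow> 'a \<Rightarrow> real" and f :: "'i \<Rightarrow> 'a \<Rightarrow> real"
  assumes \<mu>: "\<mu> \<in> Mplus \<Omega>" and \<nu>: "\<nu> \<in> Mplus \<Omega>" and \<nu>': "\<nu>' \<in> Mplus \<Omega>"
    and c_meas: "(\<lambda>z. c (fst z) (snd z)) \<in> borel_measurable (restrict_space borel (\<Omega> \<times> \<Omega>))"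
    and c_nonneg: "\<And>x y. 0 \<le> c x y"
    and T: "finite T"
    and f_meas: "\<And>i. i \<in> T \<Longrightarrow> f i \<in> borel_measurable (restrict_space borel \<Omega>)"
    and f_nonneg: "\<And>i y. i \<in> T \<Longrightarrow> y \<in> \<Omega> \<Longrightarrow> 0 \<le> f i y"
    and f_sum: "\<And>y. y \<in> \<Omega> \<Longrightarrow> (\<Sum>i\<in>T. f i y) = 1"
    and osc: "\<And>i x y y'. i \<in> T \<Longrightarrow> x \<in> \<Omega> \<Longrightarrow> y \<in> \<Omega> \<Longrightarrow> y' \<in> \<Omega> \<Longrightarrow> 0 < f i y \<Longrightarrow> 0 < f i y' \<Longrightarrow> c x y' \<le> c x y + \<omega>"
    and nonneg: "0 \<le> \<omega>" "0 \<le> \<epsilon>" "0 \<le> \<theta>" "0 \<le> d" and t: "0 < t" "t \<le> 1"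
    and near: "\<And>i. i \<in> T \<Longrightarrow> 0 < (\<integral>y. f i y \<partial>\<nu>') \<Longrightarrow> (\<integral>y. f i y \<partial>\<nu>) \<le> exp \<epsilon> * (\<integral>y. f i y \<partial>\<nu>')"
    and small: "(\<Sum>i | i \<in> T \<and> (\<integral>y. f i y \<partial>\<nu>') = 0. \<integral>y. f i y \<partial>\<nu>) \<le> t * \<theta>"
    and mass: "measure \<nu>' \<Omega> \<le> measure \<nu> \<Omega> + d"
  shows "HK_fun \<Omega> (\<lambda>x y. ennreal (c x y)) \<mu> \<nu>' \<le> ennreal (1 + (\<epsilon> + \<omega>)) * HK_fun \<Omega> (\<lambda>x y. ennreal (c x y)) \<mu> \<nu>
    + ennreal (2 * (\<epsilon> + \<omega>) * measure \<nu> \<Omega> + t * measure \<mu> \<Omega> + \<theta> + d)"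
proof -
  let ?X = "borel_of (top_of_set \<Omega>)"
  let ?X' = "restrict_space borel \<Omega> :: 'a measure"
  let ?XX = "restrict_space borel (\<Omega> \<times> \<Omega>) :: ('a \<times> 'a) measure"
  \<comment> \<open>The four errors are: absorbing the mass of the plan into its energy, the
    additive price of dropping mass in the first marginal, the \<nu>-mass of the dropped cells
    divided by \<open>t\<close>, and the excess of mass of \<nu>' over \<nu>.\<close>
  define R where "R = 2 * (\<epsilon> + \<omega>) * measure \<nu> \<Omega> + t * measure \<mu> \<Omega> + \<theta> + d"
  have R0: "0 \<le> R" unfolding R_def using nonneg t by auto
  interpret \<mu>: finite_measure \<mu> by (rule Mplus_finite[OF \<mu>])
  interpret \<nu>: finite_measure \<nu> by (rule Mplus_finite[OF \<nu>])
  interpret \<nu>': finite_measure \<nu>' by (rule Mplus_finite[OF \<nu>'])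
  note sp = Mplus_space[OF \<mu>] Mplus_space[OF \<nu>] Mplus_space[OF \<nu>']
  note [measurable_cong] = Mplus_sets[OF \<mu>] Mplus_sets[OF \<nu>] Mplus_sets[OF \<nu>'] sets_borel_of_top_of_set
  note [measurable] = f_meas c_meas
  have proj: "fst \<in> measurable N ?X" "snd \<in> measurable N ?X" "fst \<in> measurable N ?X'" "snd \<in> measurable N ?X'"
    if "sets N = sets ?XX" for N :: "('a \<times> 'a) measure"
    using that by (simp_all add: measurable_cong_sets[OF that refl] borel_of_cong measurable_restrict_Times)
  define a where "a i = (\<integral>y. f i y \<partial>\<nu>)" for i
  define b where "b i = (\<integral>y. f i y \<partial>\<nu>')" for i
  have f_le1: "f i y \<le> 1" if "i \<in> T" "y \<in> \<Omega>" for i y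
    using member_le_sum[OF that(1), of "\<lambda>i. f i y"] f_nonneg f_sum that T by auto
  have f_int\<nu>: "integrable \<nu> (f i)" if "i \<in> T" for i
    using that f_nonneg f_le1 by (intro \<nu>.integrable_const_bound[where B=1]) (auto simp: sp)
  have f_int\<nu>': "integrable \<nu>' (f i)" if "i \<in> T" for i
    using that f_nonneg f_le1 by (intro \<nu>'.integrable_const_bound[where B=1]) (auto simp: sp)
  have a0: "0 \<le> a i" and b0: "0 \<le> b i" if "i \<in> T" for i
    using that f_nonneg by (auto simp: a_def b_def sp intro!: integral_nonneg_AE)
  have suma: "(\<Sum>i\<in>T. a i) = measure \<nu> \<Omega>"
  proof -
    have "(\<Sum>i\<in>T. a i) = (\<integral>y. (\<Sum>i\<in>T. f i y) \<partial>\<nu>)"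
      unfolding a_def using f_int\<nu> by simp
    also have "\<dots> = (\<integral>y. 1 \<partial>\<nu>)" using f_sum by (intro Bochner_Integration.integral_cong) (auto simp: sp)
    finally show ?thesis by (simp add: sp)
  qed
  have sumb: "(\<Sum>i\<in>T. b i) = measure \<nu>' \<Omega>"
  proof -
    have "(\<Sum>i\<in>T. b i) = (\<integral>y. (\<Sum>i\<in>T. f i y) \<partial>\<nu>')"
      unfolding b_def using f_int\<nu>' by simp
    also have "\<dots> = (\<integral>y. 1 \<partial>\<nu>')" using f_sum by (intro Bochner_Integration.integral_cong) (auto simp: sp)
    finally show ?thesis by (simp add: sp)
  qed
  have "HK_fun \<Omega> (\<lambda>x y. ennreal (c x y)) \<mu> \<nu>' \<le> ennreal (1 + (\<epsilon> + \<omega>)) * HK_energy \<Omega> (\<lambda>x y. ennreal (c x y)) \<mu> \<nu> \<gamma> + ennreal R"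
    if \<gamma>: "\<gamma> \<in> Mplus (\<Omega> \<times> \<Omega>)" for \<gamma>
  proof (cases "HK_energy \<Omega> (\<lambda>x y. ennreal (c x y)) \<mu> \<nu> \<gamma> = top")
    case True
    with nonneg show ?thesis by (simp add: ennreal_mult_top)
  next
    case False
    interpret \<gamma>: finite_measure \<gamma> by (rule Mplus_finite[OF \<gamma>])
    note [measurable_cong] = Mplus_sets[OF \<gamma>]
    note [measurable] = proj[OF Mplus_sets[OF \<gamma>]]
    have sp\<gamma>: "space \<gamma> = \<Omega> \<times> \<Omega>" by (rule Mplus_space[OF \<gamma>])
    define C0 where "C0 = (\<integral>\<^sup>+ z. ennreal (c (fst z) (snd z)) \<partial>\<gamma>)"
    define K1 where "K1 = KL (distr \<gamma> ?X fst) \<mu>"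
    define K2 where "K2 = KL (distr \<gamma> ?X snd) \<nu>"
    have E: "HK_energy \<Omega> (\<lambda>x y. ennreal (c x y)) \<mu> \<nu> \<gamma> = C0 + K1 + K2"
      unfolding HK_energy_def C0_def K1_def K2_def case_prod_beta ..
    with False have fin: "C0 \<noteq> top" "K1 \<noteq> top" "K2 \<noteq> top" by (auto simp: top_add)
    define \<sigma> where "\<sigma> = distr \<gamma> ?X snd"
    have fin\<sigma>: "finite_measure \<sigma>" unfolding \<sigma>_def by (intro \<gamma>.finite_measure_distr) measurable
    have ac: "absolutely_continuous \<nu> \<sigma>" using fin(3) by (auto simp: K2_def KL_def \<sigma>_def split: if_splits)
    have s\<sigma>: "sets \<sigma> = sets \<nu>" by (simp add: \<sigma>_def sets_borel_of_top_of_set Mplus_sets[OF \<nu>])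
    obtain r where r [measurable]: "r \<in> borel_measurable \<nu>" and r0: "\<And>x. 0 \<le> r x"
      and \<sigma>r: "\<sigma> = density \<nu> (\<lambda>x. ennreal (r x))"
      using absolutely_continuous_density_real[OF \<nu>.finite_measure_axioms fin\<sigma> s\<sigma> ac] by blast
    have K2r: "K2 = (\<integral>\<^sup>+ x. ennreal (kl_phi (r x)) \<partial>\<nu>)"
      unfolding K2_def \<sigma>_def[symmetric] \<sigma>r using r0 by (intro KL_density \<nu>.finite_measure_axioms) auto
    have \<phi>0: "0 \<le> kl_phi (r x)" for x using kl_phi_nonneg r0 by blast
    have \<phi>_int: "integrable \<nu> (\<lambda>x. kl_phi (r x))"
      using \<phi>0 fin(3) by (intro integrableI_nonneg) (auto simp: K2r top.not_eq_extremum)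
    define Kr where "Kr = (\<integral>x. kl_phi (r x) \<partial>\<nu>)"
    have K2Kr: "K2 = ennreal Kr" unfolding K2r Kr_def using \<phi>0 by (intro nn_integral_eq_integral \<phi>_int) auto
    have Kr0: "0 \<le> Kr" unfolding Kr_def using \<phi>0 by simp
    have "emeasure \<sigma> (space \<nu>) < top"
      using finite_measure.emeasure_finite[OF fin\<sigma>, of "space \<nu>"] by (simp add: top.not_eq_extremum)
    then have r_int: "integrable \<nu> r"
      using r0 unfolding \<sigma>r by (intro integrableI_nonneg) (auto simp: emeasure_density cong: nn_integral_cong)
    define G where "G = measure \<gamma> (\<Omega> \<times> \<Omega>)"
    define s where "s i = (\<integral>z. f i (snd z) \<partial>\<gamma>)" for i
    have s_r: "(\<integral>z. h (snd z) \<partial>\<gamma>) = (\<integral>y. h y * r y \<partial>\<nu>)" if [measurable]: "h \<in> borel_measurable ?X'" for h :: "'a \<Rightarrow> real"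
    proof -
      have "(\<integral>z. h (snd z) \<partial>\<gamma>) = (\<integral>y. h y \<partial>\<sigma>)"
        unfolding \<sigma>_def by (intro integral_distr[symmetric]) measurable
      also have "\<dots> = (\<integral>y. h y * r y \<partial>\<nu>)"
        unfolding \<sigma>r using r0 by (subst integral_density) (auto simp: mult.commute)
      finally show ?thesis .
    qed
    have G_r: "G = (\<integral>y. r y \<partial>\<nu>)" using s_r[of "\<lambda>_. 1"] by (simp add: G_def sp\<gamma>)
    have f_int\<gamma>: "integrable \<gamma> (\<lambda>z. f i (snd z))" if "i \<in> T" for i
      using that f_nonneg f_le1 by (intro \<gamma>.integrable_const_bound[where B=1]) (auto simp: sp\<gamma>)
    have s0: "0 \<le> s i" if "i \<in> T" for i
      using that f_nonneg by (auto simp: s_def sp\<gamma> intro!: integral_nonneg_AE)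
    have sums: "(\<Sum>i\<in>T. s i) = G"
    proof -
      have "(\<Sum>i\<in>T. s i) = (\<integral>z. (\<Sum>i\<in>T. f i (snd z)) \<partial>\<gamma>)"
        unfolding s_def using f_int\<gamma> by simp
      also have "\<dots> = (\<integral>z. 1 \<partial>\<gamma>)" using f_sum by (intro Bochner_Integration.integral_cong) (auto simp: sp\<gamma>)
      finally show ?thesis by (simp add: sp\<gamma> G_def)
    qed
    have fr_int: "integrable \<nu> (\<lambda>y. f i y * r y)" if "i \<in> T" for i
      using that f_nonneg f_le1 r0
      by (intro Bochner_Integration.integrable_bound[OF r_int]) (auto simp: sp abs_mult intro!: mult_left_le_one_le)
    have f\<phi>_int: "integrable \<nu> (\<lambda>y. f i y * kl_phi (r y))" if "i \<in> T" for i
      using that f_nonneg f_le1 \<phi>0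
      by (intro Bochner_Integration.integrable_bound[OF \<phi>_int]) (auto simp: sp abs_mult intro!: mult_left_le_one_le)
    define F where "F i = (\<integral>y. f i y * kl_phi (r y) \<partial>\<nu>)" for i
    have sumF: "(\<Sum>i\<in>T. F i) = Kr"
    proof -
      have "(\<Sum>i\<in>T. F i) = (\<integral>y. (\<Sum>i\<in>T. f i y * kl_phi (r y)) \<partial>\<nu>)"
        unfolding F_def using f\<phi>_int by simp
      also have "\<dots> = Kr" unfolding Kr_def using f_sum
        by (intro Bochner_Integration.integral_cong) (auto simp: sp sum_distrib_right[symmetric])
      finally show ?thesis .
    qed
    \<comment> \<open>For \<open>a i > 0\<close> the supremum over \<open>l\<close> of the left side
      is \<open>a i * kl_phi (s i / a i)\<close>, the entropy of the plan seen at the scale of the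
      cell. Keeping \<open>l\<close> free avoids dividing by \<open>a i\<close> and lets each case
      below choose its own slope.\<close>
    have fenchel: "l * s i - (exp l - 1) * a i \<le> F i" if i: "i \<in> T" for i l
    proof -
      have "l * s i - (exp l - 1) * a i = (\<integral>y. l * (f i y * r y) - (exp l - 1) * f i y \<partial>\<nu>)"
        using i fr_int[OF i] f_int\<nu>[OF i] f_meas[OF i] by (simp add: s_def s_r a_def)
      also have "\<dots> \<le> F i" unfolding F_def
      proof (intro integral_mono f\<phi>_int i)
        show "integrable \<nu> (\<lambda>y. l * (f i y * r y) - (exp l - 1) * f i y)"
          using i fr_int[OF i] f_int\<nu>[OF i] by simp
        fix y assume "y \<in> space \<nu>"
        then have "f i y * (l * r y - exp l + 1) \<le> f i y * kl_phi (r y)"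
          using i f_nonneg r0 by (intro mult_left_mono kl_phi_fenchel) (auto simp: sp)
        then show "l * (f i y * r y) - (exp l - 1) * f i y \<le> f i y * kl_phi (r y)"
          by (simp add: algebra_simps)
      qed
      finally show ?thesis .
    qed
    \<comment> \<open>This is the slope \<open>l = 1\<close> summed over all cells, with
      \<open>exp 1 - 1 \<le> 2\<close>. It lets every error proportional to the mass
      \<open>G\<close> be charged to the energy.\<close>
    have G_le: "G \<le> Kr + 2 * measure \<nu> \<Omega>"
    proof -
      have "(\<Sum>i\<in>T. 1 * s i - (exp 1 - 1) * a i) \<le> (\<Sum>i\<in>T. F i)" by (intro sum_mono fenchel)
      then have "G - (exp 1 - 1) * measure \<nu> \<Omega> \<le> Kr"
        by (simp add: sum_subtractf sums suma sumF sum_distrib_left[symmetric])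
      moreover have "(exp 1 - 1) * measure \<nu> \<Omega> \<le> 2 * measure \<nu> \<Omega>"
        using exp_le by (intro mult_right_mono) auto
      ultimately show ?thesis by simp
    qed
    define q where "q i = s i / b i" for i
    have q0: "0 \<le> q i" if "i \<in> T" for i using s0[OF that] b0[OF that] by (simp add: q_def)
    define Z where "Z = {i \<in> T. b i = 0}"
    \<comment> \<open>Once summed, \<open>b i - a i\<close> becomes the difference of total masses,
      and the conditional term survives only on the dropped cells.\<close>
    have cell: "b i * kl_phi (q i) \<le> F i + \<epsilon> * s i + b i - a i
        + (if b i = 0 then a i / t + ln t * s i else 0)" if i: "i \<in> T" for i
    proof (cases "b i = 0")
      case True
      \<comment> \<open>The slope is chosen so that the arriving mass \<open>s i\<close> is weighted
        by exactly \<open>- ln t\<close>, the price of dropping it in the first marginal;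
        \<open>exp (- ln t)\<close> produces the factor \<open>1 / t\<close> on
        \<open>a i\<close>.\<close>
      have "(- ln t) * s i - (exp (- ln t) - 1) * a i \<le> F i" by (rule fenchel[OF i])
      moreover have "exp (- ln t) = 1 / t" using t by (simp add: exp_minus inverse_eq_divide)
      ultimately have "0 \<le> F i - a i + a i / t + ln t * s i" by (simp add: algebra_simps)
      moreover have "0 \<le> \<epsilon> * s i" using nonneg(2) s0[OF i] by simp
      ultimately show ?thesis using True by simp
    next
      case False
      with b0[OF i] have b: "0 < b i" by simp
      show ?thesis
      proof (cases "s i = 0")
        case True
        \<comment> \<open>With no arriving mass the best slope is minus infinity, hence the limit at
          \<open>at_bot\<close>.\<close>
        have "a i - F i \<le> exp l * a i" for l using fenchel[OF i, of l] True by (simp add: algebra_simps)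
        moreover have "((\<lambda>l. exp l * a i) \<longlongrightarrow> 0 * a i) at_bot"
          by (intro tendsto_mult tendsto_const exp_at_bot)
        ultimately have "a i - F i \<le> 0 * a i"
          by (intro tendsto_lowerbound[where F=at_bot]) auto
        with True b nonneg(2) show ?thesis by (simp add: q_def kl_phi_def)
      next
        case False
        with s0[OF i] have s: "0 < s i" by simp
        have q: "0 < q i" using s b by (simp add: q_def)
        have bq: "b i * q i = s i" using b by (simp add: q_def)
        \<comment> \<open>The slope \<open>ln (q i)\<close> would be optimal for cell mass
          \<open>b i\<close>. Lowering it by \<epsilon> compensates for
          \<open>a i \<le> exp \<epsilon> * b i\<close> and costs
          \<open>\<epsilon> * s i\<close>.\<close>
        have "exp (ln (q i) - \<epsilon>) * a i = q i * (exp (- \<epsilon>) * a i)"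
          using q by (simp add: exp_diff exp_minus divide_inverse)
        also have "\<dots> \<le> q i * b i"
          using near[OF i] b q unfolding a_def[symmetric] b_def[symmetric]
          by (intro mult_left_mono) (auto simp: exp_minus field_simps)
        finally have "exp (ln (q i) - \<epsilon>) * a i \<le> s i" using bq by (simp add: mult.commute)
        moreover have "b i * kl_phi (q i) = s i * ln (q i) - s i + b i"
        proof -
          have "b i * kl_phi (q i) = (b i * q i) * ln (q i) - b i * q i + b i"
            using q by (simp add: kl_phi_def algebra_simps)
          then show ?thesis by (simp add: bq)
        qed
        ultimately show ?thesis
          using fenchel[OF i, of "ln (q i) - \<epsilon>"] b by (simp add: algebra_simps)
      qed
    qed
    define SZ where "SZ = (\<Sum>i\<in>Z. s i)"
    have SZ0: "0 \<le> SZ" unfolding SZ_def using s0 by (intro sum_nonneg) (auto simp: Z_def)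
    define X where "X = (\<Sum>i\<in>T. b i * kl_phi (q i))"
    \<comment> \<open>The term \<open>ln t * SZ\<close> is nonpositive; it is the gain reserved to
      cancel the price of the dropped mass in the first marginal.\<close>
    have X_le: "X \<le> Kr + \<epsilon> * G + d + \<theta> + ln t * SZ"
    proof -
      have "X \<le> (\<Sum>i\<in>T. F i + \<epsilon> * s i + b i - a i + (if b i = 0 then a i / t + ln t * s i else 0))"
        unfolding X_def by (intro sum_mono cell)
      also have "\<dots> = Kr + \<epsilon> * G + measure \<nu>' \<Omega> - measure \<nu> \<Omega> + (\<Sum>i\<in>Z. a i / t + ln t * s i)"
        unfolding Z_def sum.inter_filter[OF T]
        by (simp add: sum.distrib[of _ "\<lambda>i. if b i = 0 then _ i else 0"] sum.distrib[of "\<lambda>i. F i + _ i"]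
            sum.distrib[of F] sum_subtractf sums suma sumb sumF sum_distrib_left[symmetric])
      also have "(\<Sum>i\<in>Z. a i / t + ln t * s i) = (\<Sum>i\<in>Z. a i) / t + ln t * SZ"
        by (simp add: sum.distrib sum_distrib_left sum_divide_distrib SZ_def)
      also have "(\<Sum>i\<in>Z. a i) / t \<le> \<theta>"
        using small t unfolding a_def[symmetric] b_def[symmetric] Z_def by (simp add: field_simps)
      finally show ?thesis using mass by simp
    qed
    \<comment> \<open>cells with \<open>b i = 0\<close> drop out of \<open>k\<close> and \<open>q\<close> because \<open>x / 0 = 0\<close>\<close>
    define k where "k y y' = (\<Sum>i\<in>T. f i y * f i y' / b i)" for y y'
    have k_meas [measurable]: "(\<lambda>z. k (fst z) (snd z)) \<in> borel_measurable ?XX"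
      unfolding k_def using f_meas by measurable
    obtain \<gamma>' where s\<gamma>': "sets \<gamma>' = sets ?XX" and \<gamma>'_int: "\<And>h. h \<in> borel_measurable ?XX \<Longrightarrow>
      (\<integral>\<^sup>+ z. h z \<partial>\<gamma>') = (\<integral>\<^sup>+ z. (\<integral>\<^sup>+ y'. ennreal (k (snd z) y') * h (fst z, y') \<partial>\<nu>') \<partial>\<gamma>)"
      using plan_kernel[OF \<gamma> \<nu>' k_meas] by blast
    note [measurable_cong] = s\<gamma>'
    note [measurable] = proj[OF s\<gamma>']
    have sp\<gamma>': "space \<gamma>' = \<Omega> \<times> \<Omega>" using sets_eq_imp_space_eq[OF s\<gamma>'] by (simp add: space_restrict_space)
    have k0: "0 \<le> k y y'" if "y \<in> \<Omega>" "y' \<in> \<Omega>" for y y'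
      unfolding k_def using that f_nonneg b0 by (intro sum_nonneg divide_nonneg_nonneg mult_nonneg_nonneg) auto
    \<comment> \<open>The share of the mass at \<open>y\<close> that the new plan keeps; the share
      \<open>1 - p y\<close> belongs to cells without \<nu>'-mass.\<close>
    define p where "p y = (\<Sum>i\<in>T - Z. f i y)" for y
    have Z: "finite Z" "Z \<subseteq> T" using T by (auto simp: Z_def)
    have p_meas [measurable]: "p \<in> borel_measurable ?X'"
      unfolding p_def[abs_def] using f_meas by (intro borel_measurable_sum) auto
    have p0: "0 \<le> p y" if "y \<in> \<Omega>" for y using that f_nonneg unfolding p_def by (intro sum_nonneg) auto
    have p_compl: "1 - p y = (\<Sum>i\<in>Z. f i y)" if "y \<in> \<Omega>" for y
      using sum.subset_diff[OF Z(2) T, of "\<lambda>i. f i y"] f_sum[OF that] by (simp add: p_def)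
    have p1: "0 \<le> 1 - p y" if "y \<in> \<Omega>" for y
      unfolding p_compl[OF that] using that f_nonneg Z by (intro sum_nonneg) auto
    have k_int\<nu>': "(\<integral>\<^sup>+ y'. ennreal (k y y') \<partial>\<nu>') = ennreal (p y)" if y: "y \<in> \<Omega>" for y
    proof -
      have "(\<integral>\<^sup>+ y'. ennreal (k y y') \<partial>\<nu>') = ennreal (\<integral>y'. k y y' \<partial>\<nu>')"
        using k0[OF y] f_int\<nu>' by (intro nn_integral_eq_integral AE_I2) (auto simp: sp k_def)
      also have "(\<integral>y'. k y y' \<partial>\<nu>') = (\<Sum>i\<in>T. f i y * b i / b i)"
        unfolding k_def using f_int\<nu>' by (subst Bochner_Integration.integral_sum) (auto simp: b_def)
      also have "\<dots> = p y"
        unfolding p_def using T by (intro sum.mono_neutral_cong_right) (auto simp: Z_def)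
      finally show ?thesis .
    qed
    have "emeasure \<gamma>' (space \<gamma>') = (\<integral>\<^sup>+ z. 1 \<partial>\<gamma>')" by simp
    also have "\<dots> = (\<integral>\<^sup>+ z. ennreal (p (snd z)) \<partial>\<gamma>)"
      by (subst \<gamma>'_int) (auto simp: sp\<gamma> k_int\<nu>' intro!: nn_integral_cong)
    also have "\<dots> \<le> (\<integral>\<^sup>+ z. ennreal 1 \<partial>\<gamma>)"
      using p1 by (intro nn_integral_mono ennreal_leI) (auto simp: sp\<gamma>)
    also have "\<dots> < top" by (simp add: \<gamma>.emeasure_finite top.not_eq_extremum[symmetric])
    finally interpret \<gamma>': finite_measure \<gamma>' by (intro finite_measureI) auto
    have \<gamma>'_M: "\<gamma>' \<in> Mplus (\<Omega> \<times> \<Omega>)"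
      using \<gamma>'.finite_measure_axioms s\<gamma>' by (simp add: finite_borel_measures_def sets_borel_of_top_of_set)

    \<comment> \<open>Where the kernel is nonzero, \<open>y\<close> and \<open>y'\<close> lie in the
      positivity set of one common \<open>f i\<close>, so the oscillation bound applies.\<close>
    have k_cost: "ennreal (k y y') * ennreal (c x y') \<le> ennreal (c x y + \<omega>) * ennreal (k y y')"
      if "x \<in> \<Omega>" "y \<in> \<Omega>" "y' \<in> \<Omega>" for x y y'
    proof (cases "k y y' = 0")
      case False
      then obtain i where i: "i \<in> T" "f i y * f i y' / b i \<noteq> 0"
        unfolding k_def by (meson sum.neutral)
      with that f_nonneg have "0 < f i y" "0 < f i y'" by (auto simp: less_le)
      with i(1) that have "c x y' \<le> c x y + \<omega>" by (intro osc) auto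
      then show ?thesis by (subst mult.commute) (intro mult_right_mono ennreal_leI, auto)
    qed simp
    have cost: "(\<integral>\<^sup>+ z. ennreal (c (fst z) (snd z)) \<partial>\<gamma>') \<le> C0 + ennreal (\<omega> * G)"
    proof -
      have "(\<integral>\<^sup>+ z. ennreal (c (fst z) (snd z)) \<partial>\<gamma>') =
        (\<integral>\<^sup>+ z. (\<integral>\<^sup>+ y'. ennreal (k (snd z) y') * ennreal (c (fst z) y') \<partial>\<nu>') \<partial>\<gamma>)"
        by (subst \<gamma>'_int) auto
      also have "\<dots> \<le> (\<integral>\<^sup>+ z. (\<integral>\<^sup>+ y'. ennreal (c (fst z) (snd z) + \<omega>) * ennreal (k (snd z) y') \<partial>\<nu>') \<partial>\<gamma>)"
        using k_cost by (intro nn_integral_mono) (auto simp: sp\<gamma> sp)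
      also have "\<dots> \<le> (\<integral>\<^sup>+ z. ennreal (c (fst z) (snd z) + \<omega>) \<partial>\<gamma>)"
      proof (intro nn_integral_mono)
        fix z assume z: "z \<in> space \<gamma>"
        then have z': "snd z \<in> \<Omega>" by (auto simp: sp\<gamma>)
        have [measurable]: "(\<lambda>y'. k (snd z) y') \<in> borel_measurable \<nu>'"
          unfolding k_def using f_meas by measurable
        have "(\<integral>\<^sup>+ y'. ennreal (c (fst z) (snd z) + \<omega>) * ennreal (k (snd z) y') \<partial>\<nu>')
          = ennreal (c (fst z) (snd z) + \<omega>) * ennreal (p (snd z))"
          by (subst nn_integral_cmult) (auto simp: k_int\<nu>' z')
        also have "\<dots> \<le> ennreal (c (fst z) (snd z) + \<omega>) * ennreal 1"
          using p1[OF z'] by (intro mult_left_mono ennreal_leI) auto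
        finally show "(\<integral>\<^sup>+ y'. ennreal (c (fst z) (snd z) + \<omega>) * ennreal (k (snd z) y') \<partial>\<nu>')
          \<le> ennreal (c (fst z) (snd z) + \<omega>)" by simp
      qed
      also have "\<dots> = C0 + (\<integral>\<^sup>+ z. ennreal \<omega> \<partial>\<gamma>)"
        unfolding C0_def using c_nonneg nonneg by (subst nn_integral_add[symmetric]) auto
      also have "(\<integral>\<^sup>+ z. ennreal \<omega> \<partial>\<gamma>) = ennreal (\<omega> * G)"
        using nonneg by (simp add: G_def sp\<gamma> \<gamma>.emeasure_eq_measure ennreal_mult)
      finally show ?thesis .
    qed

    have marg1: "KL (distr \<gamma>' ?X fst) \<mu> \<le> K1 + ennreal (t * measure \<mu> \<Omega>) + ennreal (- ln t * SZ)"
    proof -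
      \<comment> \<open>The dropped part of the plan. Its first marginal and that of
        \<open>\<gamma>'\<close> add up to the first marginal of \<gamma>, as \<open>KL_drop\<close>
        requires, and its mass is \<open>SZ\<close>.\<close>
      define \<gamma>2 where "\<gamma>2 = density \<gamma> (\<lambda>z. ennreal (1 - p (snd z)))"
      have s2: "sets \<gamma>2 = sets ?XX" by (simp add: \<gamma>2_def Mplus_sets[OF \<gamma>])
      note [measurable_cong] = s2
      note [measurable] = proj[OF s2]
      have sp2: "space \<gamma>2 = \<Omega> \<times> \<Omega>" by (simp add: \<gamma>2_def sp\<gamma>)
      have "emeasure \<gamma>2 (\<Omega> \<times> \<Omega>) = (\<integral>\<^sup>+ z. ennreal (1 - p (snd z)) \<partial>\<gamma>)"
        unfolding \<gamma>2_def sp\<gamma>[symmetric] by (subst emeasure_density) (auto cong: nn_integral_cong)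
      also have "\<dots> = (\<integral>\<^sup>+ z. ennreal (\<Sum>i\<in>Z. f i (snd z)) \<partial>\<gamma>)"
        using p_compl by (intro nn_integral_cong) (auto simp: sp\<gamma>)
      also have "\<dots> = ennreal (\<integral>z. (\<Sum>i\<in>Z. f i (snd z)) \<partial>\<gamma>)"
        using Z f_int\<gamma> f_nonneg
        by (intro nn_integral_eq_integral AE_I2 Bochner_Integration.integrable_sum) (auto simp: sp\<gamma> intro!: sum_nonneg)
      also have "(\<integral>z. (\<Sum>i\<in>Z. f i (snd z)) \<partial>\<gamma>) = SZ"
        unfolding SZ_def s_def using Z f_int\<gamma> by (intro Bochner_Integration.integral_sum) auto
      finally have em2: "emeasure \<gamma>2 (\<Omega> \<times> \<Omega>) = ennreal SZ" .
      interpret \<gamma>2: finite_measure \<gamma>2 by (rule finite_measureI) (simp add: sp2 em2)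
      have "KL (distr \<gamma>' ?X fst) \<mu> \<le> KL (distr \<gamma> ?X fst) \<mu> + ennreal t * emeasure \<mu> (space \<mu>)
          + ennreal (- ln t) * emeasure (distr \<gamma>2 ?X fst) (space \<mu>)"
      proof (intro KL_drop \<mu>.finite_measure_axioms \<gamma>'.finite_measure_distr \<gamma>2.finite_measure_distr t)
        fix A assume "A \<in> sets \<mu>"
        then have A [measurable]: "A \<in> sets ?X" "A \<in> sets ?X'"
          by (simp_all add: Mplus_sets[OF \<mu>] sets_borel_of_top_of_set)
        have e: "emeasure (distr N ?X fst) A = (\<integral>\<^sup>+ z. indicator A (fst z) \<partial>N)"
          if "sets N = sets ?XX" for N :: "('a \<times> 'a) measure"
          using proj[OF that] by (subst nn_integral_distr[where f="indicator A" and T=fst and M'="?X", symmetric]) auto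
        have "emeasure (distr \<gamma>' ?X fst) A = (\<integral>\<^sup>+ z. indicator A (fst z) \<partial>\<gamma>')"
          by (rule e) (rule s\<gamma>')
        also have "\<dots> = (\<integral>\<^sup>+ z. ennreal (p (snd z)) * indicator A (fst z) \<partial>\<gamma>)"
        proof (subst \<gamma>'_int)
          show "(\<integral>\<^sup>+ z. (\<integral>\<^sup>+ y'. ennreal (k (snd z) y') * indicator A (fst (fst z, y')) \<partial>\<nu>') \<partial>\<gamma>)
            = (\<integral>\<^sup>+ z. ennreal (p (snd z)) * indicator A (fst z) \<partial>\<gamma>)"
          proof (intro nn_integral_cong)
            fix z assume z: "z \<in> space \<gamma>"
            have [measurable]: "(\<lambda>y'. k (snd z) y') \<in> borel_measurable \<nu>'"
              unfolding k_def using f_meas by measurable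
            from z show "(\<integral>\<^sup>+ y'. ennreal (k (snd z) y') * indicator A (fst (fst z, y')) \<partial>\<nu>') = ennreal (p (snd z)) * indicator A (fst z)"
              by (subst fst_conv, subst nn_integral_multc) (auto simp: k_int\<nu>' sp\<gamma>)
          qed
        qed measurable
        finally have e1: "emeasure (distr \<gamma>' ?X fst) A = (\<integral>\<^sup>+ z. ennreal (p (snd z)) * indicator A (fst z) \<partial>\<gamma>)" .
        have "emeasure (distr \<gamma>2 ?X fst) A = (\<integral>\<^sup>+ z. indicator A (fst z) \<partial>\<gamma>2)"
          by (rule e) (rule s2)
        also have "\<dots> = (\<integral>\<^sup>+ z. ennreal (1 - p (snd z)) * indicator A (fst z) \<partial>\<gamma>)"
          unfolding \<gamma>2_def by (subst nn_integral_density) auto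
        finally have e2: "emeasure (distr \<gamma>2 ?X fst) A = (\<integral>\<^sup>+ z. ennreal (1 - p (snd z)) * indicator A (fst z) \<partial>\<gamma>)" .
        have "emeasure (distr \<gamma>' ?X fst) A + emeasure (distr \<gamma>2 ?X fst) A
          = (\<integral>\<^sup>+ z. ennreal (p (snd z)) * indicator A (fst z) + ennreal (1 - p (snd z)) * indicator A (fst z) \<partial>\<gamma>)"
          unfolding e1 e2 by (subst nn_integral_add) auto
        also have "\<dots> = (\<integral>\<^sup>+ z. indicator A (fst z) \<partial>\<gamma>)"
          using p0 p1 by (intro nn_integral_cong) (auto simp: sp\<gamma> distrib_right[symmetric] ennreal_plus[symmetric] simp del: ennreal_plus)
        also have "\<dots> = emeasure (distr \<gamma> ?X fst) A" by (rule e[symmetric]) (rule Mplus_sets[OF \<gamma>])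
        finally show "emeasure (distr \<gamma> ?X fst) A = emeasure (distr \<gamma>' ?X fst) A + emeasure (distr \<gamma>2 ?X fst) A" ..
      qed (simp_all add: Mplus_sets[OF \<mu>] sets_borel_of_top_of_set, measurable)
      also have "emeasure (distr \<gamma>2 ?X fst) (space \<mu>) = ennreal SZ"
      proof -
        have "emeasure (distr \<gamma>2 ?X fst) (space ?X) = emeasure \<gamma>2 (fst -` space ?X \<inter> space \<gamma>2)"
          by (rule emeasure_distr) measurable
        also have "fst -` space ?X \<inter> space \<gamma>2 = \<Omega> \<times> \<Omega>" by (auto simp: sp2)
        finally show ?thesis by (simp add: em2 sp)
      qed
      finally show ?thesis
        using t SZ0 by (simp add: K1_def sp \<mu>.emeasure_eq_measure ennreal_mult[symmetric])
    qed

    define g where "g y = (\<Sum>i\<in>T. f i y * q i)" for y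
    have g_meas [measurable]: "g \<in> borel_measurable ?X'" unfolding g_def[abs_def] using f_meas by measurable
    have g0: "0 \<le> g y" if "y \<in> \<Omega>" for y
      unfolding g_def using that f_nonneg q0 by (intro sum_nonneg mult_nonneg_nonneg) auto
    have k_int\<gamma>: "(\<integral>\<^sup>+ z. ennreal (k (snd z) y) \<partial>\<gamma>) = ennreal (g y)" if y: "y \<in> \<Omega>" for y
    proof -
      have "(\<integral>\<^sup>+ z. ennreal (k (snd z) y) \<partial>\<gamma>) = ennreal (\<integral>z. k (snd z) y \<partial>\<gamma>)"
        using k0[OF _ y] f_int\<gamma> by (intro nn_integral_eq_integral AE_I2) (auto simp: sp\<gamma> k_def)
      also have "(\<integral>z. k (snd z) y \<partial>\<gamma>) = g y"
        unfolding k_def g_def q_def using f_int\<gamma>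
        by (subst Bochner_Integration.integral_sum) (auto simp: s_def intro!: sum.cong)
      finally show ?thesis .
    qed
    have marg2: "distr \<gamma>' ?X snd = density \<nu>' (\<lambda>y. ennreal (g y))"
    proof (rule measure_eqI)
      show "sets (distr \<gamma>' ?X snd) = sets (density \<nu>' (\<lambda>y. ennreal (g y)))"
        by (simp add: Mplus_sets[OF \<nu>'] sets_borel_of_top_of_set)
      fix A assume "A \<in> sets (distr \<gamma>' ?X snd)"
      then have A [measurable]: "A \<in> sets ?X" "A \<in> sets ?X'"
        by (simp_all add: sets_borel_of_top_of_set)
      interpret P: pair_sigma_finite \<gamma> \<nu>' ..
      have m1: "(\<lambda>w. (snd (fst w), snd w)) \<in> measurable (\<gamma> \<Otimes>\<^sub>M \<nu>') ?XX"
        by (rule measurable_Pair_restrict) measurable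
      have [measurable]: "(\<lambda>w. k (snd (fst w)) (snd w)) \<in> borel_measurable (\<gamma> \<Otimes>\<^sub>M \<nu>')"
        using measurable_compose[OF m1 k_meas] by simp
      have "emeasure (distr \<gamma>' ?X snd) A = (\<integral>\<^sup>+ z. indicator A (snd z) \<partial>\<gamma>')"
        by (subst nn_integral_distr[where f="indicator A" and T=snd and M'="?X", symmetric]) auto
      also have "\<dots> = (\<integral>\<^sup>+ z. (\<integral>\<^sup>+ y'. ennreal (k (snd z) y') * indicator A y' \<partial>\<nu>') \<partial>\<gamma>)"
        by (subst \<gamma>'_int) auto
      also have "\<dots> = (\<integral>\<^sup>+ y'. (\<integral>\<^sup>+ z. ennreal (k (snd z) y') * indicator A y' \<partial>\<gamma>) \<partial>\<nu>')"
        by (rule P.Fubini'[symmetric]) (simp add: case_prod_beta)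
      also have "\<dots> = (\<integral>\<^sup>+ y'. ennreal (g y') * indicator A y' \<partial>\<nu>')"
      proof (intro nn_integral_cong)
        fix y' assume y': "y' \<in> space \<nu>'"
        have [measurable]: "(\<lambda>z. k (snd z) y') \<in> borel_measurable \<gamma>"
          unfolding k_def using f_meas by measurable
        from y' show "(\<integral>\<^sup>+ z. ennreal (k (snd z) y') * indicator A y' \<partial>\<gamma>) = ennreal (g y') * indicator A y'"
          by (subst nn_integral_multc) (auto simp: k_int\<gamma> sp)
      qed
      also have "\<dots> = emeasure (density \<nu>' (\<lambda>y. ennreal (g y))) A"
        by (subst emeasure_density) auto
      finally show "emeasure (distr \<gamma>' ?X snd) A = emeasure (density \<nu>' (\<lambda>y. ennreal (g y))) A" .
    qed
    \<comment> \<open>At each point \<open>g\<close> averages the ratios \<open>q i\<close> with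
      weights \<open>f i y\<close> summing to 1, so Jensen applies pointwise. Integrating the
      weights against \<nu>' turns them into \<open>b i\<close>.\<close>
    have marg2': "KL (distr \<gamma>' ?X snd) \<nu>' \<le> ennreal X"
    proof -
      have "KL (distr \<gamma>' ?X snd) \<nu>' = (\<integral>\<^sup>+ y. ennreal (kl_phi (g y)) \<partial>\<nu>')"
        unfolding marg2 using g0 by (intro KL_density \<nu>'.finite_measure_axioms) (auto simp: sp)
      also have "\<dots> \<le> (\<integral>\<^sup>+ y. ennreal (\<Sum>i\<in>T. f i y * kl_phi (q i)) \<partial>\<nu>')"
        unfolding g_def using T f_nonneg q0 f_sum
        by (intro nn_integral_mono ennreal_leI kl_phi_convex_sum) (auto simp: sp)
      also have "\<dots> = ennreal (\<integral>y. (\<Sum>i\<in>T. f i y * kl_phi (q i)) \<partial>\<nu>')"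
        using f_int\<nu>' f_nonneg kl_phi_nonneg[OF q0]
        by (intro nn_integral_eq_integral AE_I2) (auto simp: sp intro!: sum_nonneg mult_nonneg_nonneg)
      also have "(\<integral>y. (\<Sum>i\<in>T. f i y * kl_phi (q i)) \<partial>\<nu>') = X"
        unfolding X_def b_def using f_int\<nu>' by (subst Bochner_Integration.integral_sum) auto
      finally show ?thesis .
    qed

    obtain c0 k1 where ck: "C0 = ennreal c0" "K1 = ennreal k1" "0 \<le> c0" "0 \<le> k1"
      using fin by (metis ennreal_cases)
    have G0: "0 \<le> G" by (simp add: G_def)
    have X0: "0 \<le> X" unfolding X_def using b0 kl_phi_nonneg[OF q0] by (intro sum_nonneg mult_nonneg_nonneg) auto
    define L where "L = - ln t * SZ"
    have L0: "0 \<le> L" unfolding L_def using t SZ0 by (intro mult_nonneg_nonneg) auto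
    have "HK_fun \<Omega> (\<lambda>x y. ennreal (c x y)) \<mu> \<nu>' \<le> HK_energy \<Omega> (\<lambda>x y. ennreal (c x y)) \<mu> \<nu>' \<gamma>'"
      unfolding HK_fun_def by (intro INF_lower \<gamma>'_M)
    also have "\<dots> \<le> (C0 + ennreal (\<omega> * G)) + (K1 + ennreal (t * measure \<mu> \<Omega>) + ennreal L) + ennreal X"
      unfolding HK_energy_def case_prod_beta L_def by (intro add_mono cost marg1 marg2')
    also have "\<dots> = ennreal ((c0 + \<omega> * G) + (k1 + t * measure \<mu> \<Omega> + L) + X)"
      unfolding ck(1,2) using ck(3,4) nonneg t G0 X0 L0
      by (simp add: ennreal_plus[symmetric] del: ennreal_plus)
    also have "\<dots> \<le> ennreal ((1 + (\<epsilon> + \<omega>)) * (c0 + k1 + Kr) + R)"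
    proof (rule ennreal_leI)
      \<comment> \<open>The mass \<open>G\<close> occurs with \<omega> from the cost and with
        \<epsilon> from the entropy; \<open>G_le\<close> moves both into the energy. The price
        \<open>L\<close> cancels against \<open>ln t * SZ\<close> in \<open>X_le\<close>.\<close>
      have "(\<epsilon> + \<omega>) * G \<le> (\<epsilon> + \<omega>) * ((c0 + k1 + Kr) + 2 * measure \<nu> \<Omega>)"
        using G_le ck nonneg by (intro mult_left_mono) auto
      then show "(c0 + \<omega> * G) + (k1 + t * measure \<mu> \<Omega> + L) + X
          \<le> (1 + (\<epsilon> + \<omega>)) * (c0 + k1 + Kr) + R"
        using X_le unfolding R_def L_def by (simp add: algebra_simps)
    qed
    also have "\<dots> = ennreal (1 + (\<epsilon> + \<omega>)) * (C0 + K1 + K2) + ennreal R"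
      unfolding ck(1,2) K2Kr using ck(3,4) Kr0 R0 nonneg
      by (simp add: ennreal_plus[symmetric] ennreal_mult[symmetric] del: ennreal_plus)
    finally show ?thesis unfolding E .
  qed
  from le_INF_affine_ennreal[OF this] nonneg show ?thesis
    unfolding R_def by (simp add: HK_fun_def)
qed

section \<open>Weak* continuity\<close>

text \<open>Tent functions of radius \<open>\<delta> / 2\<close> around a finite net, divided by
  their sum, which is positive on \<Omega>. Each is positive only within \<open>\<delta> / 2\<close>
  of its centre, whence the diameter bound. Where the sum vanishes outside \<Omega>, division by
  zero gives the harmless value 0.\<close>

lemma compact_partition_of_unity:
  fixes \<Omega> :: "'a::euclidean_space set"
  assumes "compact \<Omega>" "0 < \<delta>"
  shows "\<exists>(T :: 'a set) (f :: 'a \<Rightarrow> 'a \<Rightarrow> real). finite T \<and> (\<forall>i\<in>T. continuous_on \<Omega> (f i) \<and> (\<forall>y. 0 \<le> f i y)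
      \<and> (\<forall>y y'. 0 < f i y \<longrightarrow> 0 < f i y' \<longrightarrow> dist y y' < \<delta>))
    \<and> (\<forall>y\<in>\<Omega>. (\<Sum>i\<in>T. f i y) = 1)"
proof -
  obtain T where T: "finite T" "\<Omega> \<subseteq> (\<Union>x\<in>T. ball x (\<delta> / 2))"
    using assms unfolding compact_eq_totally_bounded by (meson half_gt_zero)
  define g where "g c y = max 0 (\<delta> / 2 - dist c y)" for c y :: 'a
  define f where "f c y = g c y / (\<Sum>c\<in>T. g c y)" for c y
  have g0: "0 \<le> g c y" for c y by (simp add: g_def)
  have pos: "0 < (\<Sum>c\<in>T. g c y)" if y: "y \<in> \<Omega>" for y
  proof -
    obtain c where c: "c \<in> T" "dist c y < \<delta> / 2" using T y by auto
    then have "0 < g c y" by (simp add: g_def)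
    also have "\<dots> \<le> (\<Sum>c\<in>T. g c y)" using c T g0 by (intro member_le_sum) auto
    finally show ?thesis .
  qed
  have "continuous_on \<Omega> (f i)" for i
    unfolding f_def g_def[abs_def] using pos
    by (intro continuous_intros) (force simp: g_def)
  moreover have "0 \<le> f i y" for i y
    unfolding f_def using g0 by (intro divide_nonneg_nonneg sum_nonneg) auto
  moreover have "(\<Sum>i\<in>T. f i y) = 1" if "y \<in> \<Omega>" for y
    using pos[OF that] by (simp add: f_def sum_divide_distrib[symmetric])
  moreover have "dist y y' < \<delta>" if "0 < f i y" "0 < f i y'" for i y y'
  proof -
    have "g i y \<noteq> 0" "g i y' \<noteq> 0" using that by (auto simp: f_def)
    then have "dist i y < \<delta> / 2" "dist i y' < \<delta> / 2" by (auto simp: g_def max_def split: if_splits)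
    then show ?thesis using dist_triangle_half_r by blast
  qed
  ultimately show ?thesis using T(1) by (intro exI[of _ T] exI[of _ f]) simp
qed

section \<open>Uniform estimates for the squared distance as a real number\<close>

lemma HK_sq_le_mass:
  assumes "\<mu> \<in> Mplus \<Omega>" "\<nu> \<in> Mplus \<Omega>"
  shows "HK_sq \<Omega> \<kappa> \<mu> \<nu> \<le> ennreal (measure \<mu> \<Omega> + measure \<nu> \<Omega>)"
  using HK_sq_le[OF assms] Mplus_finite[OF assms(1)] Mplus_finite[OF assms(2)]
  by (simp add: finite_measure.emeasure_eq_measure)

lemma HK_sq_ennreal:
  assumes "\<mu> \<in> Mplus \<Omega>" "\<nu> \<in> Mplus \<Omega>"
  shows "ennreal (enn2real (HK_sq \<Omega> \<kappa> \<mu> \<nu>)) = HK_sq \<Omega> \<kappa> \<mu> \<nu>"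
  by (intro ennreal_enn2real le_less_trans[OF HK_sq_le_mass[OF assms]]) simp

lemma HK_sq_real_le_mass:
  assumes "\<mu> \<in> Mplus \<Omega>" "\<nu> \<in> Mplus \<Omega>"
  shows "enn2real (HK_sq \<Omega> \<kappa> \<mu> \<nu>) \<le> measure \<mu> \<Omega> + measure \<nu> \<Omega>"
  by (intro enn2real_leI HK_sq_le_mass assms) simp

text \<open>All parameters of the stability estimate, including the truncation level, are set to
  \<open>u\<close>; hence the bound \<open>u * u\<close> on the empty cells. Since the squared
  distance is at most \<open>B\<close>, the relative error becomes additive, and the collected terms
  fit into \<open>10 * u * B\<close>.\<close>

lemma HK_sq_one_sided:
  fixes \<Omega> :: "'a::euclidean_space set" and f :: "'i \<Rightarrow> 'a \<Rightarrow> real"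
  assumes \<mu>: "\<mu> \<in> Mplus \<Omega>" and \<nu>: "\<nu> \<in> Mplus \<Omega>" and \<nu>': "\<nu>' \<in> Mplus \<Omega>"
    and \<kappa>: "0 < \<kappa>" and u: "0 < u" "u \<le> 1"
    and T: "finite T" "\<And>i. i \<in> T \<Longrightarrow> continuous_on \<Omega> (f i)" "\<And>i y. i \<in> T \<Longrightarrow> 0 \<le> f i y"
    "\<And>y. y \<in> \<Omega> \<Longrightarrow> (\<Sum>i\<in>T. f i y) = 1"
    and osc: "\<And>i x y y'. i \<in> T \<Longrightarrow> x \<in> \<Omega> \<Longrightarrow> y \<in> \<Omega> \<Longrightarrow> y' \<in> \<Omega> \<Longrightarrow> 0 < f i y \<Longrightarrow> 0 < f i y' \<Longrightarrow>
      trunc_cost \<kappa> u x y' \<le> trunc_cost \<kappa> u x y + u"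
    and near: "\<And>i. i \<in> T \<Longrightarrow> 0 < (\<integral>y. f i y \<partial>\<nu>') \<Longrightarrow> (\<integral>y. f i y \<partial>\<nu>) \<le> exp u * (\<integral>y. f i y \<partial>\<nu>')"
    and small: "(\<Sum>i | i \<in> T \<and> (\<integral>y. f i y \<partial>\<nu>') = 0. \<integral>y. f i y \<partial>\<nu>) \<le> u * u"
    and mass: "measure \<nu>' \<Omega> \<le> measure \<nu> \<Omega> + u"
    and B: "1 \<le> B" "measure \<mu> \<Omega> + measure \<nu> \<Omega> \<le> B" "measure \<mu> \<Omega> + measure \<nu>' \<Omega> \<le> B"
  shows "enn2real (HK_sq \<Omega> \<kappa> \<mu> \<nu>') \<le> enn2real (HK_sq \<Omega> \<kappa> \<mu> \<nu>) + 10 * u * B"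
proof -
  define h h' where "h = enn2real (HK_sq \<Omega> \<kappa> \<mu> \<nu>)" and "h' = enn2real (HK_sq \<Omega> \<kappa> \<mu> \<nu>')"
  have h: "HK_sq \<Omega> \<kappa> \<mu> \<nu> = ennreal h" and h': "HK_sq \<Omega> \<kappa> \<mu> \<nu>' = ennreal h'"
    unfolding h_def h'_def by (intro HK_sq_ennreal[symmetric] \<mu> \<nu> \<nu>')+
  have h0: "0 \<le> h" by (simp add: h_def)
  have hB: "h \<le> B"
    using HK_sq_real_le_mass[OF \<mu> \<nu>, of \<kappa>] B unfolding h_def by linarith
  let ?c = "\<lambda>x y. ennreal (trunc_cost \<kappa> u x y)"
  have m: "emeasure \<mu> \<Omega> = ennreal (measure \<mu> \<Omega>)" "emeasure \<nu>' \<Omega> = ennreal (measure \<nu>' \<Omega>)"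
    using finite_measure.emeasure_eq_measure[OF Mplus_finite[OF \<mu>]]
      finite_measure.emeasure_eq_measure[OF Mplus_finite[OF \<nu>']] by blast+
  have "ennreal h' \<le> HK_fun \<Omega> ?c \<mu> \<nu>' + ennreal (u * (measure \<mu> \<Omega> + measure \<nu>' \<Omega>))"
    using HK_sq_le_trunc[OF \<mu> \<nu>' u \<kappa>] u unfolding h' m by (simp add: ennreal_mult)
  also have "HK_fun \<Omega> ?c \<mu> \<nu>' \<le> ennreal (1 + (u + u)) * HK_fun \<Omega> ?c \<mu> \<nu>
      + ennreal (2 * (u + u) * measure \<nu> \<Omega> + u * measure \<mu> \<Omega> + u + u)"
    using u T
    by (intro HK_fun_stability[where f=f and T=T] \<mu> \<nu> \<nu>' osc near small mass trunc_cost_nonneg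
          measurable_restrict_space1 trunc_cost_measurable borel_measurable_continuous_on_restrict) auto
  also have "HK_fun \<Omega> ?c \<mu> \<nu> \<le> ennreal h"
    unfolding h[symmetric] HK_sq_eq_HK_fun by (intro HK_fun_mono trunc_cost_le_hk_cost u \<kappa>)
  finally have "ennreal h' \<le> ennreal (1 + (u + u)) * ennreal h
      + ennreal (2 * (u + u) * measure \<nu> \<Omega> + u * measure \<mu> \<Omega> + u + u)
      + ennreal (u * (measure \<mu> \<Omega> + measure \<nu>' \<Omega>))"
    by (simp add: add_mono mult_left_mono)
  also have "\<dots> = ennreal ((1 + (u + u)) * h + (2 * (u + u) * measure \<nu> \<Omega> + u * measure \<mu> \<Omega> + u + u)
      + u * (measure \<mu> \<Omega> + measure \<nu>' \<Omega>))"
    using u h0 by (simp add: ennreal_plus[symmetric] ennreal_mult[symmetric] del: ennreal_plus)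
  finally have "h' \<le> (1 + (u + u)) * h + (2 * (u + u) * measure \<nu> \<Omega> + u * measure \<mu> \<Omega> + u + u)
      + u * (measure \<mu> \<Omega> + measure \<nu>' \<Omega>)"
    using u h0 by (subst (asm) ennreal_le_iff) (auto intro!: add_nonneg_nonneg mult_nonneg_nonneg)
  also have "\<dots> = h + u * (2 * h + 4 * measure \<nu> \<Omega> + measure \<mu> \<Omega> + 2 + (measure \<mu> \<Omega> + measure \<nu>' \<Omega>))"
    by (simp add: algebra_simps)
  also have "\<dots> \<le> h + u * (10 * B)"
  proof -
    have "0 \<le> measure \<mu> \<Omega>" "0 \<le> measure \<nu> \<Omega>" "0 \<le> measure \<nu>' \<Omega>" by (rule measure_nonneg)+
    with B hB have "2 * h + 4 * measure \<nu> \<Omega> + measure \<mu> \<Omega> + 2 + (measure \<mu> \<Omega> + measure \<nu>' \<Omega>) \<le> 10 * B"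
      by linarith
    with u show ?thesis by (intro add_left_mono mult_left_mono) auto
  qed
  finally show ?thesis unfolding h_def h'_def by simp
qed

text \<open>The stability estimate sees \<nu>' only through finitely many integrals and \<mu> only
  through its mass, so one weak* open set \<open>V\<close> serves all \<mu> of mass at most
  \<open>M\<close>. The open-set form, rather than a sequential one, is what continuity between
  topologies calls for.\<close>

lemma HK_sq_weak_star_neighbourhood:
  fixes \<Omega> :: "'a::euclidean_space set"
  assumes \<Omega>: "compact \<Omega>" and \<nu>: "\<nu> \<in> Mplus \<Omega>" and \<kappa>: "0 < \<kappa>" and M: "0 \<le> M" and e: "0 < e"
  obtains V where "openin (weak_star (top_of_set \<Omega>)) V" "\<nu> \<in> V"
    "\<And>\<mu> \<nu>'. \<mu> \<in> Mplus \<Omega> \<Longrightarrow> measure \<mu> \<Omega> \<le> M \<Longrightarrow> \<nu>' \<in> V \<Longrightarrow>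
      \<bar>enn2real (HK_sq \<Omega> \<kappa> \<mu> \<nu>') - enn2real (HK_sq \<Omega> \<kappa> \<mu> \<nu>)\<bar> \<le> e"
proof -
  \<comment> \<open>The summand 1 covers \<nu>', whose mass will exceed that of \<nu> by less than
    \<open>u \<le> 1\<close>.\<close>
  define B where "B = M + measure \<nu> \<Omega> + 1"
  have B: "1 \<le> B" using M by (simp add: B_def)
  define u where "u = min 1 (e / (10 * B))"
  have u: "0 < u" "u \<le> 1" using B e by (auto simp: u_def)
  have "u * (10 * B) \<le> e / (10 * B) * (10 * B)" using B by (intro mult_right_mono) (auto simp: u_def)
  then have uB: "10 * u * B \<le> e" using B by simp
  have "uniformly_continuous_on (\<Omega> \<times> \<Omega>) (\<lambda>z. trunc_cost \<kappa> u (fst z) (snd z))"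
    using \<Omega> u \<kappa> by (intro compact_uniformly_continuous trunc_cost_continuous compact_Times)
  then have "\<exists>\<delta>>0. \<forall>z\<in>\<Omega> \<times> \<Omega>. \<forall>z'\<in>\<Omega> \<times> \<Omega>. dist z' z < \<delta> \<longrightarrow>
      dist (trunc_cost \<kappa> u (fst z') (snd z')) (trunc_cost \<kappa> u (fst z) (snd z)) < u"
    unfolding uniformly_continuous_on_def using u(1) by blast
  then obtain \<delta> where \<delta>: "0 < \<delta> \<and> (\<forall>z\<in>\<Omega> \<times> \<Omega>. \<forall>z'\<in>\<Omega> \<times> \<Omega>. dist z' z < \<delta> \<longrightarrow>
      dist (trunc_cost \<kappa> u (fst z') (snd z')) (trunc_cost \<kappa> u (fst z) (snd z)) < u)" ..
  obtain T :: "'a set" and f :: "'a \<Rightarrow> 'a \<Rightarrow> real" where Tf: "finite T \<and> (\<forall>i\<in>T. continuous_on \<Omega> (f i) \<and> (\<forall>y. 0 \<le> f i y)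
      \<and> (\<forall>y y'. 0 < f i y \<longrightarrow> 0 < f i y' \<longrightarrow> dist y y' < \<delta>))
    \<and> (\<forall>y\<in>\<Omega>. (\<Sum>i\<in>T. f i y) = 1)"
    using compact_partition_of_unity[OF \<Omega> conjunct1[OF \<delta>]] by (elim exE)
  then have T: "finite T" "\<And>i. i \<in> T \<Longrightarrow> continuous_on \<Omega> (f i)" "\<And>i y. i \<in> T \<Longrightarrow> 0 \<le> f i y"
    "\<And>y. y \<in> \<Omega> \<Longrightarrow> (\<Sum>i\<in>T. f i y) = 1"
    and diam: "\<And>i y y'. i \<in> T \<Longrightarrow> 0 < f i y \<Longrightarrow> 0 < f i y' \<Longrightarrow> dist y y' < \<delta>"
    by simp_all
  have osc: "trunc_cost \<kappa> u x y' \<le> trunc_cost \<kappa> u x y + u"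
    if "i \<in> T" "x \<in> \<Omega>" "y \<in> \<Omega>" "y' \<in> \<Omega>" "0 < f i y" "0 < f i y'" for i x y y'
    using conjunct2[OF \<delta>, rule_format, of "(x, y)" "(x, y')"] diam[OF that(1,6,5)] that
    by (auto simp: dist_Pair_Pair dist_real_def)
  define a where "a i = (\<integral>y. f i y \<partial>\<nu>)" for i
  have int0: "0 \<le> (\<integral>y. f i y \<partial>\<rho>)" if "i \<in> T" for i \<rho> using T(3)[OF that] by simp
  \<comment> \<open>Cells charged by \<nu> get a two-sided ratio condition. On uncharged cells no
    ratio is available, only smallness; the denominator keeps the sum over all such cells within
    \<open>u * u\<close> and is never zero.\<close>
  define U where "U i = (if a i = 0 then {x. x < u * u / (card T + 1)} else {x. a i < exp u * x} \<inter> {x. x < exp u * a i})" for i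
  have openU: "open (U i)" for i
    unfolding U_def by (auto intro!: open_Int open_Collect_less continuous_intros)
  have eu: "1 < exp u" using u by simp
  have aU: "a i \<in> U i" if "i \<in> T" for i
    using int0[OF that, of \<nu>] u eu by (auto simp: U_def a_def[symmetric])
  define W where "W = {\<nu>' \<in> Mplus \<Omega>. (\<integral>y. 1 \<partial>\<nu>') \<in> {x. \<bar>x - measure \<nu> \<Omega>\<bar> < u}}"
  define V where "V = W \<inter> (\<Inter>i\<in>T. {\<nu>' \<in> Mplus \<Omega>. (\<integral>y. f i y \<partial>\<nu>') \<in> U i})"
  have basic: "openin (weak_star (top_of_set \<Omega>)) {\<nu>' \<in> Mplus \<Omega>. (\<integral>y. h y \<partial>\<nu>') \<in> S}"
    if "continuous_on \<Omega> h" "open S" for h :: "'a \<Rightarrow> real" and S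
    unfolding weak_star_def using that
    by (intro topology_generated_by_Basis CollectI exI[of _ h] exI[of _ S]) simp
  show ?thesis
  proof
    have W: "openin (weak_star (top_of_set \<Omega>)) W"
      unfolding W_def by (intro basic continuous_intros open_Collect_less)
    then show "openin (weak_star (top_of_set \<Omega>)) V"
    \<comment> \<open>The rule for finite intersections needs a nonempty index set, and
      \<open>T\<close> may be empty when \<Omega> is.\<close>
    proof (cases "T = {}")
      case False
      with W show ?thesis
        unfolding V_def using T openU by (intro openin_Int openin_INT2 basic) auto
    qed (simp add: V_def)
    show "\<nu> \<in> V"
      using \<nu> aU u by (auto simp: V_def W_def a_def Mplus_space)
    fix \<mu> \<nu>' assume \<mu>: "\<mu> \<in> Mplus \<Omega>" "measure \<mu> \<Omega> \<le> M" and "\<nu>' \<in> V"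
    then have \<nu>': "\<nu>' \<in> Mplus \<Omega>" and mass: "\<bar>measure \<nu>' \<Omega> - measure \<nu> \<Omega>\<bar> < u"
      and inU: "\<And>i. i \<in> T \<Longrightarrow> (\<integral>y. f i y \<partial>\<nu>') \<in> U i"
      by (auto simp: V_def W_def Mplus_space)
    define b where "b i = (\<integral>y. f i y \<partial>\<nu>')" for i
    have bz: "b i < u * u / (card T + 1)" if "i \<in> T" "a i = 0" for i
      using inU[OF that(1)] that by (simp add: U_def b_def)
    have bn: "a i < exp u * b i" "b i < exp u * a i" if "i \<in> T" "a i \<noteq> 0" for i
      using inU[OF that(1)] that by (auto simp: U_def b_def)
    have b0: "0 \<le> b i" if "i \<in> T" for i using int0[OF that] by (simp add: b_def)
    have "enn2real (HK_sq \<Omega> \<kappa> \<mu> \<nu>') \<le> enn2real (HK_sq \<Omega> \<kappa> \<mu> \<nu>) + 10 * u * B"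
    proof (rule HK_sq_one_sided[where f=f and T=T, OF \<mu>(1) \<nu> \<nu>' \<kappa> u T osc])
      show "(\<integral>y. f i y \<partial>\<nu>) \<le> exp u * (\<integral>y. f i y \<partial>\<nu>')" if "i \<in> T" for i
        using bn(1)[OF that] b0[OF that] unfolding a_def[symmetric] b_def[symmetric] by (cases "a i = 0") auto
      \<comment> \<open>From \<nu> to \<nu>' nothing of \<nu> is lost: the ratio condition forces
        \<open>b i > 0\<close> in every charged cell.\<close>
      have "(\<Sum>i | i \<in> T \<and> b i = 0. a i) = 0"
      proof (rule sum.neutral, safe)
        fix i assume "i \<in> T" "b i = 0"
        then show "a i = 0" using bn(1)[of i] int0[of i \<nu>] by (auto simp: a_def[symmetric])
      qed
      then show "(\<Sum>i | i \<in> T \<and> (\<integral>y. f i y \<partial>\<nu>') = 0. \<integral>y. f i y \<partial>\<nu>) \<le> u * u"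
        using u unfolding a_def[symmetric] b_def[symmetric] by simp
    qed (use mass B \<mu>(2) u in \<open>auto simp: B_def\<close>)
    moreover have "enn2real (HK_sq \<Omega> \<kappa> \<mu> \<nu>) \<le> enn2real (HK_sq \<Omega> \<kappa> \<mu> \<nu>') + 10 * u * B"
    proof (rule HK_sq_one_sided[where f=f and T=T, OF \<mu>(1) \<nu>' \<nu> \<kappa> u T osc])
      show "(\<integral>y. f i y \<partial>\<nu>') \<le> exp u * (\<integral>y. f i y \<partial>\<nu>)" if "i \<in> T" "0 < (\<integral>y. f i y \<partial>\<nu>)" for i
        using bn(2)[OF that(1)] that(2) unfolding a_def[symmetric] b_def[symmetric] by auto
      \<comment> \<open>From \<nu>' to \<nu> the empty cells are those uncharged by \<nu>, where
        \<nu>' may still have mass. This is the direction in which dropping is really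
        needed.\<close>
      have "(\<Sum>i | i \<in> T \<and> a i = 0. b i) \<le> (\<Sum>i | i \<in> T \<and> a i = 0. u * u / (card T + 1))"
        using bz by (intro sum_mono) (auto intro: less_imp_le)
      also have "\<dots> \<le> (\<Sum>i\<in>T. u * u / (card T + 1))"
        using T(1) u by (intro sum_mono2) auto
      also have "\<dots> \<le> u * u" using u by (simp add: field_simps)
      finally show "(\<Sum>i | i \<in> T \<and> (\<integral>y. f i y \<partial>\<nu>) = 0. \<integral>y. f i y \<partial>\<nu>') \<le> u * u"
        unfolding a_def b_def .
    qed (use mass B \<mu>(2) u in \<open>auto simp: B_def\<close>)
    ultimately show "\<bar>enn2real (HK_sq \<Omega> \<kappa> \<mu> \<nu>') - enn2real (HK_sq \<Omega> \<kappa> \<mu> \<nu>)\<bar> \<le> e"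
      using uB by linarith
  qed
qed

text \<open>By symmetry the varying measure moves to the second argument, and the fixed \<nu> takes
  the role of the measure of bounded mass, with bound \<open>measure \<nu> \<Omega>\<close>.\<close>

lemma continuous_map_HK_sq:
  fixes \<Omega> :: "'a::euclidean_space set"
  assumes "compact \<Omega>" "\<nu> \<in> Mplus \<Omega>" "0 < \<kappa>"
  shows "continuous_map (mass_bounded \<Omega> M) euclideanreal (\<lambda>\<mu>. enn2real (HK_sq \<Omega> \<kappa> \<mu> \<nu>))"
  unfolding continuous_map_def
proof (intro conjI allI impI)
  fix S :: "real set" assume "openin euclideanreal S"
  then have S: "open S" by simp
  let ?P = "{\<mu> \<in> topspace (mass_bounded \<Omega> M). enn2real (HK_sq \<Omega> \<kappa> \<mu> \<nu>) \<in> S}"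
  show "openin (mass_bounded \<Omega> M) ?P"
  proof (subst openin_subopen, safe)
    fix \<mu> assume \<mu>: "\<mu> \<in> topspace (mass_bounded \<Omega> M)" "enn2real (HK_sq \<Omega> \<kappa> \<mu> \<nu>) \<in> S"
    obtain e where e: "0 < e" "\<And>y. dist y (enn2real (HK_sq \<Omega> \<kappa> \<mu> \<nu>)) < e \<Longrightarrow> y \<in> S"
      using S \<mu>(2) by (auto simp: open_dist)
    have "\<mu> \<in> Mplus \<Omega>" using \<mu>(1) by simp
    then obtain V where V: "openin (weak_star (top_of_set \<Omega>)) V" "\<mu> \<in> V"
      "\<And>\<rho> \<mu>'. \<rho> \<in> Mplus \<Omega> \<Longrightarrow> measure \<rho> \<Omega> \<le> measure \<nu> \<Omega> \<Longrightarrow> \<mu>' \<in> V \<Longrightarrow>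
      \<bar>enn2real (HK_sq \<Omega> \<kappa> \<rho> \<mu>') - enn2real (HK_sq \<Omega> \<kappa> \<rho> \<mu>)\<bar> \<le> e / 2"
      using HK_sq_weak_star_neighbourhood[OF assms(1) _ assms(3), of \<mu> "measure \<nu> \<Omega>" "e / 2"] e(1) by auto
    let ?V = "V \<inter> {\<mu> \<in> Mplus \<Omega>. measure \<mu> \<Omega> \<le> M}"
    have "openin (mass_bounded \<Omega> M) ?V"
      unfolding mass_bounded_def openin_subtopology using V(1) by blast
    moreover have "\<mu> \<in> ?V" using V(2) \<mu>(1) by simp
    moreover have "?V \<subseteq> ?P"
    proof
      fix \<mu>' assume "\<mu>' \<in> ?V"
      with V(3)[OF assms(2), of \<mu>'] e show "\<mu>' \<in> ?P"
        by (auto simp: HK_sq_sym[of \<Omega> \<kappa> _ \<nu>] dist_real_def)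
    qed
    ultimately show "\<exists>V. openin (mass_bounded \<Omega> M) V \<and> \<mu> \<in> V \<and> V \<subseteq> ?P" by blast
  qed
qed simp

section \<open>Integration over the space of mass-bounded measures\<close>

lemma continuous_map_borel_measurable:
  assumes "sets L = sets (borel_of X)" "continuous_map X euclideanreal h"
  shows "h \<in> borel_measurable L"
proof (rule borel_measurableI)
  fix S :: "real set" assume "open S"
  then have "openin X {x \<in> topspace X. h x \<in> S}"
    using assms(2) by (auto simp: continuous_map_def)
  moreover have "h -` S \<inter> space L = {x \<in> topspace X. h x \<in> S}"
    using sets_eq_imp_space_eq[OF assms(1)] by auto
  ultimately show "h -` S \<inter> space L \<in> sets L"
    unfolding assms(1) sets_borel_of by (simp add: sigma_sets.Basic)
qed

text \<open>Weak* convergence speaks of Bochner integrals of real functions, while \<open>J\<close>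
  is a nonnegative integral in \<open>ennreal\<close>. Continuity gives measurability of the
  integrand, and the mass bound \<open>M + measure \<nu> \<Omega>\<close> gives integrability, so
  the two integrals agree.\<close>

lemma J_eq_integral:
  fixes \<Omega> :: "'a::euclidean_space set"
  assumes "compact \<Omega>" "0 < \<kappa>" "\<Lambda> \<in> borel_prob_measures (mass_bounded \<Omega> M)" "\<nu> \<in> Mplus \<Omega>"
  shows "integrable \<Lambda> (\<lambda>\<mu>. enn2real (HK_sq \<Omega> \<kappa> \<mu> \<nu>))"
    and "J \<Omega> \<kappa> \<Lambda> \<nu> = ennreal (\<integral>\<mu>. enn2real (HK_sq \<Omega> \<kappa> \<mu> \<nu>) \<partial>\<Lambda>)"
proof -
  have s: "sets \<Lambda> = sets (borel_of (mass_bounded \<Omega> M))" and "prob_space \<Lambda>"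
    using assms(3) by (auto simp: borel_prob_measures_def finite_borel_measures_def)
  then interpret prob_space \<Lambda> by simp
  have sp: "space \<Lambda> = {\<mu> \<in> Mplus \<Omega>. measure \<mu> \<Omega> \<le> M}"
    using sets_eq_imp_space_eq[OF s] by simp
  have [measurable]: "(\<lambda>\<mu>. enn2real (HK_sq \<Omega> \<kappa> \<mu> \<nu>)) \<in> borel_measurable \<Lambda>"
    using s continuous_map_HK_sq[OF assms(1,4,2)] by (rule continuous_map_borel_measurable)
  have "enn2real (HK_sq \<Omega> \<kappa> \<mu> \<nu>) \<le> M + measure \<nu> \<Omega>" if "\<mu> \<in> space \<Lambda>" for \<mu>
    using HK_sq_real_le_mass[of \<mu> \<Omega> \<nu> \<kappa>] that sp assms(4) by auto
  then show int: "integrable \<Lambda> (\<lambda>\<mu>. enn2real (HK_sq \<Omega> \<kappa> \<mu> \<nu>))"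
    by (intro integrable_const_bound[where B="M + measure \<nu> \<Omega>"]) auto
  have "J \<Omega> \<kappa> \<Lambda> \<nu> = (\<integral>\<^sup>+ \<mu>. ennreal (enn2real (HK_sq \<Omega> \<kappa> \<mu> \<nu>)) \<partial>\<Lambda>)"
    unfolding J_def using sp assms(4) by (intro nn_integral_cong) (auto simp: HK_sq_ennreal)
  also have "\<dots> = ennreal (\<integral>\<mu>. enn2real (HK_sq \<Omega> \<kappa> \<mu> \<nu>) \<partial>\<Lambda>)"
    by (intro nn_integral_eq_integral int) auto
  finally show "J \<Omega> \<kappa> \<Lambda> \<nu> = ennreal (\<integral>\<mu>. enn2real (HK_sq \<Omega> \<kappa> \<mu> \<nu>) \<partial>\<Lambda>)" .
qed

theorem proposition3p2:
  fixes \<Omega> :: "'a::euclidean_space set" and M \<kappa> :: real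
    and \<Lambda>s :: "nat \<Rightarrow> 'a measure measure" and \<Lambda> :: "'a measure measure"
    and \<nu>s :: "nat \<Rightarrow> 'a measure" and \<nu> :: "'a measure"
  assumes "compact \<Omega>" "convex \<Omega>" "interior \<Omega> \<noteq> {}"
    and "0 < M" "0 < \<kappa>"
    and "\<And>n. \<Lambda>s n \<in> borel_prob_measures (mass_bounded \<Omega> M)"
    and "\<Lambda> \<in> borel_prob_measures (mass_bounded \<Omega> M)"
    and "limitin (weak_star (mass_bounded \<Omega> M)) \<Lambda>s \<Lambda> sequentially"
    and "\<And>n. \<nu>s n \<in> Mplus \<Omega>" "\<nu> \<in> Mplus \<Omega>"
    and "limitin (weak_star (top_of_set \<Omega>)) \<nu>s \<nu> sequentially"
  shows "(\<lambda>n. J \<Omega> \<kappa> (\<Lambda>s n) (\<nu>s n)) \<longlonglongrightarrow> J \<Omega> \<kappa> \<Lambda> \<nu>"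
  proof -
  let ?H = "\<lambda>\<nu> \<mu>. enn2real (HK_sq \<Omega> \<kappa> \<mu> \<nu>)"
  have \<Lambda>: "\<Lambda>s n \<in> finite_borel_measures (mass_bounded \<Omega> M)" "\<Lambda> \<in> finite_borel_measures (mass_bounded \<Omega> M)"
    and prob: "prob_space (\<Lambda>s n)" for n
    using assms(6)[of n] assms(7) by (auto simp: borel_prob_measures_def)
  \<comment> \<open>With \<nu> fixed the integrand is a continuous test function on the space of
    mass-bounded measures.\<close>
  have lim: "(\<lambda>n. \<integral>\<mu>. ?H \<nu> \<mu> \<partial>\<Lambda>s n) \<longlonglongrightarrow> (\<integral>\<mu>. ?H \<nu> \<mu> \<partial>\<Lambda>)"
    using assms(8) continuous_map_HK_sq[OF assms(1,10,5)] by (simp add: limitin_weak_star[OF \<Lambda>])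
  \<comment> \<open>Replacing \<open>\<nu>s n\<close> by \<nu> changes the integrand by an amount
    that is small uniformly in \<mu>, so the bound holds under every probability measure
    \<open>\<Lambda>s n\<close>.\<close>
  have "(\<lambda>n. (\<integral>\<mu>. ?H (\<nu>s n) \<mu> \<partial>\<Lambda>s n) - (\<integral>\<mu>. ?H \<nu> \<mu> \<partial>\<Lambda>s n)) \<longlonglongrightarrow> 0"
  proof (rule tendstoI)
    fix e :: real assume e: "0 < e"
    obtain V where V: "openin (weak_star (top_of_set \<Omega>)) V" "\<nu> \<in> V"
      "\<And>\<mu> \<nu>'. \<mu> \<in> Mplus \<Omega> \<Longrightarrow> measure \<mu> \<Omega> \<le> M \<Longrightarrow> \<nu>' \<in> V \<Longrightarrow> \<bar>?H \<nu>' \<mu> - ?H \<nu> \<mu>\<bar> \<le> e / 2"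
      using HK_sq_weak_star_neighbourhood[OF assms(1,10,5), of M "e / 2"] e assms(4) by auto
    have "eventually (\<lambda>n. \<nu>s n \<in> V) sequentially"
      using assms(11) V(1,2) by (auto simp: limitin_def)
    then show "eventually (\<lambda>n. dist ((\<integral>\<mu>. ?H (\<nu>s n) \<mu> \<partial>\<Lambda>s n) - (\<integral>\<mu>. ?H \<nu> \<mu> \<partial>\<Lambda>s n)) 0 < e) sequentially"
    proof eventually_elim
      case (elim n)
      interpret prob_space "\<Lambda>s n" by (rule prob)
      note int = J_eq_integral(1)[OF assms(1,5) assms(6)[of n]]
      have sp: "space (\<Lambda>s n) = {\<mu> \<in> Mplus \<Omega>. measure \<mu> \<Omega> \<le> M}"
        using \<Lambda>(1)[of n] sets_eq_imp_space_eq[of "\<Lambda>s n" "borel_of (mass_bounded \<Omega> M)"]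
        unfolding finite_borel_measures_def[of "mass_bounded \<Omega> M"] by simp
      have "\<bar>\<integral>\<mu>. ?H (\<nu>s n) \<mu> - ?H \<nu> \<mu> \<partial>\<Lambda>s n\<bar> \<le> (\<integral>\<mu>. \<bar>?H (\<nu>s n) \<mu> - ?H \<nu> \<mu>\<bar> \<partial>\<Lambda>s n)"
        by (rule integral_abs_bound)
      also have "\<dots> \<le> (\<integral>\<mu>. e / 2 \<partial>\<Lambda>s n)"
        using int assms(9,10) V(3) elim sp
        by (intro integral_mono integrable_abs Bochner_Integration.integrable_diff) auto
      also have "\<dots> < e" using e by (simp add: prob_space)
      finally show ?case using int assms(9,10) by (simp add: dist_real_def)
    qed
  qed
  from tendsto_add[OF this lim] have "(\<lambda>n. \<integral>\<mu>. ?H (\<nu>s n) \<mu> \<partial>\<Lambda>s n) \<longlonglongrightarrow> (\<integral>\<mu>. ?H \<nu> \<mu> \<partial>\<Lambda>)"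
    by simp
  then show ?thesis
    unfolding J_eq_integral(2)[OF assms(1,5,6,9)] J_eq_integral(2)[OF assms(1,5,7,10)]
    by (rule tendsto_ennrealI)
qed

end
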